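(* Let $(\bar x(\cdot),\bar u(\cdot))\in W^{1,2}([0,\bar T];\mathbb R^n)\times L^2([0,\bar T];\mathbb R^d)$ be a feasible solution to problem $(P)$ (with duration $\bar T$) described in the context, and let assumptions (H1), (H2), (H3) of the context hold. For $k\in\mathbb N$ put $h^k:=\bar T/k$ and $t^k_i:=ih^k$, $i=0,\ldots,k$. Then the following hold. (i) There exists a sequence of piecewise constant control functions $u^k:[0,\bar T]\to U$, $k\in\mathbb N$, such that $u^k(\cdot)\to\bar u(\cdot)$ strongly in $L^2([0,\bar T];\mathbb R^d)$ as $k\to\infty$. (ii) There exists a sequence of piecewise linear functions $x^k:[0,\bar T]\to\mathbb R^n$, $k\in\mathbb N$, converging strongly to $\bar x(\cdot)$ in the $W^{1,2}$-norm topology on $[0,\bar T]$ and such that, for all $k\in\mathbb N$, $x^k(0)=\bar x(0)$ and, for all $i=0,\ldots,k-1$, $$\dot x^k(t)\in -N\big(x^k(t^k_i);C^k_i\big)+g\big(x^k(t^k_i),u^k(t^k_i)\big)+\tau^k_i\mathbb B,\qquad t\in[t^k_i,t^k_{i+1}),$$ where $\tau^k_i\ge 0$ satisfy $h^k\sum_{i=1}^{k-1}\tau^k_i\to 0$ as $k\to\infty$, and where the perturbed polyhedra $C^k_i$ are $$C^k_i:=\bigcap_{j=1}^s C^k_{ij},\qquad C^k_{ij}:=\big\{x\in\mathbb R^n\;\big|\;\langle x,x^j_*(t^k_i)\rangle\le c^{ij}_k\big\},$$ generated by the vectors $x^j_*(t^k_i)$ and suitable real numbers $c^{ij}_k$.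 (iii) For each $j=1,\ldots,s$ the piecewise linear extensions to $[0,\bar T]$ of $c^{ij}_k$ and $x^j_*(t^k_i)$ (from the grid points $t^k_i$) converge uniformly on $[0,\bar T]$, as $k\to\infty$, to $c_j(t)$ and $x^j_*(t)$, respectively. Finally, all $x^k(\cdot)$ are Lipschitz continuous on $[0,\bar T]$ with the same Lipschitz constant as $\bar x(\cdot)$.
   Context: Problem $(P)$: minimize $J[x,u,T]:=\varphi(x(T),T)$ over measurable controls $u(\cdot)$, trajectories $x(\cdot)$ and durations $T$ satisfying $$\dot x(t)\in -N\big(x(t);C(t)\big)+g\big(x(t),u(t)\big)\ \text{a.e. } t\in[0,T],\quad x(0)=x_0\in C(0)\subset\mathbb R^n,$$ $$u(t)\in U\subset\mathbb R^d\ \text{a.e. } t\in[0,T],\qquad (x(T),T)\in\Omega_x\times\Omega_T\subset\mathbb R^n\times[0,\infty).$$ Triples satisfying these constraints are called feasible. Here $$C(t):=\bigcap_{j=1}^s\{x\in\mathbb R^n\mid\langle x^j_*(t),x\rangle\le c_j(t)\},\quad \|x^j_*(t)\|=1,\ j=1,\ldots,s,\ t\in[0,\infty),$$ and for a convex set $C$, $N(x;C):=\{v\mid\langle v,y-x\rangle\le 0\ \forall y\in C\}$ if $x\in C$ and $N(x;C):=\emptyset$ if $x\notin C$. $\mathbb B$ is the closed unit ball of $\mathbb R^n$. The norm is $\|x\|_{W^{1,2}}:=\|x(0)\|+\|\dot x\|_{L^2}$. Assumptions: (H1) $U\ne\emptyset$ is closed and bounded in $\mathbb R^d$; the functions $x^j_*(\cdot)$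 and $c_j(\cdot)$ are Lipschitz continuous with a common Lipschitz constant. (H2) (uniform Slater condition) For every $t\in[0,\bar T]$ there is $x\in\mathbb R^n$ with $\langle x^j_*(t),x\rangle<c_j(t)$ for all $j=1,\ldots,s$. (H3) $g:\mathbb R^n\times U\to\mathbb R^n$ is Lipschitz continuous with respect to $(x,u)$ whenever $u\in U$ and $x$ belongs to a bounded subset of $\mathbb R^n$, and $\|g(x,u)\|\le\beta(1+\|x\|)$ for all $u\in U$ with some constant $\beta>0$. The piecewise linear extension of grid values is the function on $[0,\bar T]$ that is affine on each $[t^k_i,t^k_{i+1}]$ and takes the given values at the grid points (constant on the last subinterval if no value is assigned at $t^k_k$). *)

theory Defs
  imports "HOL-Analysis.Analysis"
begin

text \<open>Function spaces on the interval \<open>[0,T]\<close>. Functions are total on the reals; only their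
  values on \<open>[0,T]\<close> matter.\<close>

definition L2_on :: "real \<Rightarrow> (real \<Rightarrow> 'a::euclidean_space) \<Rightarrow> bool" where
  "L2_on T f \<longleftrightarrow> set_borel_measurable lebesgue {0..T} f \<and>
                set_integrable lebesgue {0..T} (\<lambda>t. (norm (f t))\<^sup>2)"

definition L2_norm :: "real \<Rightarrow> (real \<Rightarrow> 'a::euclidean_space) \<Rightarrow> real" where
  "L2_norm T f = sqrt (LINT t:{0..T}|lebesgue. (norm (f t))\<^sup>2)"

definition L2_converges ::
    "real \<Rightarrow> (nat \<Rightarrow> real \<Rightarrow> 'a::euclidean_space) \<Rightarrow> (real \<Rightarrow> 'a) \<Rightarrow> bool" where
  "L2_converges T f g \<longleftrightarrow> (\<forall>k\<ge>1. L2_on T (f k)) \<and> L2_on T g \<and>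
     (\<lambda>k. L2_norm T (\<lambda>t. f k t - g t)) \<longlonglongrightarrow> 0"

definition velocity :: "real \<Rightarrow> (real \<Rightarrow> 'a::euclidean_space) \<Rightarrow> real \<Rightarrow> 'a" where
  "velocity T x t = vector_derivative x (at t within {0..T})"

text \<open>Absolute continuity in the sense of the Newton--Leibniz formula: the derivative exists almost
  everywhere, is integrable, and recovers the function.\<close>

definition abs_cont_on :: "real \<Rightarrow> (real \<Rightarrow> 'a::euclidean_space) \<Rightarrow> bool" where
  "abs_cont_on T x \<longleftrightarrow>
     (AE t in lebesgue. t \<in> {0..T} \<longrightarrow> x differentiable (at t within {0..T})) \<and>
     set_integrable lebesgue {0..T} (velocity T x) \<and>
     (\<forall>t\<in>{0..T}. x t = x 0 + (LINT r:{0..t}|lebesgue. velocity T x r))"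

definition W12_on :: "real \<Rightarrow> (real \<Rightarrow> 'a::euclidean_space) \<Rightarrow> bool" where
  "W12_on T x \<longleftrightarrow> abs_cont_on T x \<and> L2_on T (velocity T x)"

definition W12_norm :: "real \<Rightarrow> (real \<Rightarrow> 'a::euclidean_space) \<Rightarrow> real" where
  "W12_norm T x = norm (x 0) + L2_norm T (velocity T x)"

definition W12_converges ::
    "real \<Rightarrow> (nat \<Rightarrow> real \<Rightarrow> 'a::euclidean_space) \<Rightarrow> (real \<Rightarrow> 'a) \<Rightarrow> bool" where
  "W12_converges T x y \<longleftrightarrow> (\<forall>k\<ge>1. W12_on T (x k)) \<and> W12_on T y \<and>
     (\<lambda>k. W12_norm T (\<lambda>t. x k t - y t)) \<longlonglongrightarrow> 0"

definition normal_cone :: "'a::euclidean_space \<Rightarrow> 'a set \<Rightarrow> 'a set" where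
  "normal_cone x C = (if x \<in> C then {v. \<forall>y\<in>C. v \<bullet> (y - x) \<le> 0} else {})"

definition poly_set :: "nat \<Rightarrow> (nat \<Rightarrow> 'a::euclidean_space) \<Rightarrow> (nat \<Rightarrow> real) \<Rightarrow> 'a set" where
  "poly_set s a b = (\<Inter>j\<in>{1..s}. {x. a j \<bullet> x \<le> b j})"

text \<open>The constraints of the sweeping control problem for a triple \<open>(x, u, T)\<close>. The inclusion
  forces \<open>x t \<in> C t\<close> almost everywhere because the normal cone is empty off the set.\<close>

definition feasible ::
    "(real \<Rightarrow> 'a::euclidean_space set) \<Rightarrow> ('a \<Rightarrow> 'b::euclidean_space \<Rightarrow> 'a) \<Rightarrow> 'b set \<Rightarrow> 'a \<Rightarrow>
     'a set \<Rightarrow> real set \<Rightarrow> (real \<Rightarrow> 'a) \<Rightarrow> (real \<Rightarrow> 'b) \<Rightarrow> real \<Rightarrow> bool" where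
  "feasible C g U x0 \<Omega>x \<Omega>T x u T \<longleftrightarrow>
     abs_cont_on T x \<and> set_borel_measurable lebesgue {0..T} u \<and>
     (AE t in lebesgue. t \<in> {0..T} \<longrightarrow>
        velocity T x t \<in> {- v + g (x t) (u t) | v. v \<in> normal_cone (x t) (C t)}) \<and>
     x 0 = x0 \<and> x0 \<in> C 0 \<and>
     (AE t in lebesgue. t \<in> {0..T} \<longrightarrow> u t \<in> U) \<and>
     (x T, T) \<in> \<Omega>x \<times> \<Omega>T"

definition grid :: "real \<Rightarrow> nat \<Rightarrow> nat \<Rightarrow> real" where
  "grid T k i = real i * (T / real k)"

definition piecewise_constant :: "real \<Rightarrow> nat \<Rightarrow> (real \<Rightarrow> 'a) \<Rightarrow> bool" where
  "piecewise_constant T k u \<longleftrightarrow>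
     (\<forall>i<k. \<exists>a. \<forall>t\<in>{grid T k i..<grid T k (Suc i)}. u t = a)"

definition piecewise_linear :: "real \<Rightarrow> nat \<Rightarrow> (real \<Rightarrow> 'a::real_vector) \<Rightarrow> bool" where
  "piecewise_linear T k x \<longleftrightarrow>
     (\<forall>i<k. \<exists>a b. \<forall>t\<in>{grid T k i..grid T k (Suc i)}. x t = a + t *\<^sub>R b)"

text \<open>Piecewise linear extension of grid values \<open>v 0, \<dots>, v k\<close>. If no value is assigned at the last
  grid point, repeating \<open>v (k - 1)\<close> there makes the extension constant on the last subinterval;
  this is \<open>pl_ext'\<close>.\<close>

definition pl_ext :: "real \<Rightarrow> nat \<Rightarrow> (nat \<Rightarrow> 'a::real_vector) \<Rightarrow> real \<Rightarrow> 'a" where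
  "pl_ext T k v t =
     (let r = t / (T / real k); i = nat \<lfloor>r\<rfloor> in v i + (r - real i) *\<^sub>R (v (Suc i) - v i))"

definition pl_ext' :: "real \<Rightarrow> nat \<Rightarrow> (nat \<Rightarrow> 'a::real_vector) \<Rightarrow> real \<Rightarrow> 'a" where
  "pl_ext' T k v = pl_ext T k (\<lambda>i. v (min i (k - 1)))"

lemma pl_ext_on_subinterval:
  assumes "0 < T" "1 \<le> k" "t \<in> {grid T k i..grid T k (Suc i)}"
  shows "pl_ext T k v t = v i + ((t - grid T k i) / (T / real k)) *\<^sub>R (v (Suc i) - v i)"
proof -
  define h where "h = T / real k"
  have h: "0 < h" using assms by (simp add: h_def)
  have 1: "real i \<le> t / h" "t / h \<le> real i + 1" "(t - grid T k i) / h = t / h - real i"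
    using assms(3) h by (auto simp: grid_def h_def[symmetric] field_simps)
  show ?thesis
  proof (cases "t / h = real i + 1")
    case True
    then have "nat \<lfloor>t / h\<rfloor> = Suc i" by linarith
    with True 1(3) show ?thesis by (simp add: pl_ext_def Let_def h_def[symmetric])
  next
    case False
    with 1 have "nat \<lfloor>t / h\<rfloor> = i" by linarith
    with 1(3) show ?thesis by (simp add: pl_ext_def Let_def h_def[symmetric])
  qed
qed

end

theory Submission
  imports Defs
begin

text \<open>By the Slater condition the normal velocities of the sweeping process are bounded, so \<open>xbar\<close> is
  Lipschitz. The pair (velocity of \<open>xbar\<close>, \<open>ubar\<close>) is therefore bounded and measurable, and it is the
  \<open>L2\<close> limit of step functions whose value on each grid cell is its own value at one well-chosen
  point \<open>S k i\<close> of that cell, outside any prescribed null set. Taking the discrete control and the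
  discrete velocity to be these sampled values preserves the Lipschitz constant and the constraint
  \<open>u \<in> U\<close>, and the sampled velocity satisfies the continuous inclusion at \<open>S k i\<close> exactly. Translating
  to \<open>x k (grid i)\<close> exactly those constraints that are active at \<open>S k i\<close> moves this inclusion to
  the grid point with an error that vanishes uniformly in \<open>i\<close>.\<close>

subsection \<open>Sampling a bounded measurable function by step functions\<close>

text \<open>Cell averages would not serve here: \<open>U\<close> is not assumed convex, so averages
  of \<open>ubar\<close> may leave it, and an average of velocities from different times belongs to
  no single normal cone. Grid values fail because the inclusion holds only almost everywhere. The
  inclusion also couples velocity and control at the same time, so one sampling point must serve
  both. The \<open>L1\<close> error of the sampled velocity bounds the uniform distance between the
  polygonal path and \<open>xbar\<close>. This is why the final error depends on \<open>k\<close>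
  alone and not on the cell. The polyhedron at a grid point need not contain the discrete state, and
  even if it does, constraints active at the sampling time may have become slack, which shrinks the
  normal cone. Moving the right-hand sides cures both defects. What is left is the rotation of the
  normals and the change of state in \<open>g\<close>. The rotation error is proportional to the
  norm of the normal vector, so the velocity bound is needed a second time, besides giving
  \<open>L2\<close> convergence from \<open>L1\<close> convergence.\<close>

lemma bounded_measurable_L1_approx:
  fixes f :: "real \<Rightarrow> 'a::euclidean_space"
  assumes f: "f \<in> borel_measurable (lebesgue_on {a..b})"
    and B: "0 \<le> B" "\<And>t. t \<in> {a..b} \<Longrightarrow> norm (f t) \<le> B" and e: "0 < e"
  shows "\<exists>\<phi>. continuous_on UNIV \<phi> \<and> (\<forall>t. norm (\<phi> t) \<le> B) \<and>
    integral {a..b} (\<lambda>t. norm (f t - \<phi> t)) < e"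
proof -
  have "f measurable_on {a..b}"
    using f by (simp add: measurable_on_iff_borel_measurable)
  then obtain N g where N: "negligible N" and g: "\<And>n. continuous_on UNIV (g n)"
    and lim: "\<And>t. t \<notin> N \<Longrightarrow> (\<lambda>n. g n t) \<longlonglongrightarrow> (if t \<in> {a..b} then f t else 0)"
    unfolding measurable_on_def by blast
  \<comment> \<open>Projection onto the ball of radius \<open>B\<close> is continuous and fixes the
    values of \<open>f\<close>, so the pointwise limit survives while the approximants gain the
    bound needed for dominated convergence.\<close>
  define p where "p = closest_point (cball (0::'a) B)"
  have p: "continuous_on UNIV p" "\<And>x. norm (p x) \<le> B" "\<And>x. norm x \<le> B \<Longrightarrow> p x = x"
    using B(1) closest_point_in_set[of "cball (0::'a) B"]
    by (auto simp: p_def intro!: continuous_on_closest_point closest_point_self)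
  have cont: "continuous_on UNIV (\<lambda>t. p (g n t))" for n
    by (rule continuous_on_compose2[OF p(1) g]) auto
  have int: "(\<lambda>t. norm (f t - p (g n t))) integrable_on {a..b}" for n
  proof (rule measurable_bounded_by_integrable_imp_integrable)
    have "(\<lambda>t. p (g n t)) \<in> borel_measurable (lebesgue_on {a..b})"
      by (intro continuous_imp_measurable_on_sets_lebesgue continuous_on_subset[OF cont]) auto
    with f show "(\<lambda>t. norm (f t - p (g n t))) \<in> borel_measurable (lebesgue_on {a..b})"
      by measurable
    show "norm (norm (f t - p (g n t))) \<le> 2 * B" if "t \<in> {a..b}" for t
      using B(2)[OF that] p(2)[of "g n t"] norm_triangle_ineq4[of "f t" "p (g n t)"] by simp
  qed auto
  \<comment> \<open>\<open>dominated_convergence\<close> asks for convergence at every point, so the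
    integrands are set to zero on the exceptional null set.\<close>
  have "(\<lambda>n. integral {a..b} (\<lambda>t. if t \<in> N then 0 else norm (f t - p (g n t))))
      \<longlonglongrightarrow> integral {a..b} (\<lambda>t. 0)"
  proof (rule dominated_convergence(2))
    show "(\<lambda>t. if t \<in> N then 0 else norm (f t - p (g n t))) integrable_on {a..b}" for n
      by (rule integrable_spike[OF int N]) auto
    show "(\<lambda>t. 2 * B) integrable_on {a..b}" by auto
    show "norm (if t \<in> N then 0 else norm (f t - p (g n t))) \<le> 2 * B" if "t \<in> {a..b}" for n t
      using B(1) B(2)[OF that] p(2)[of "g n t"] norm_triangle_ineq4[of "f t" "p (g n t)"] by simp
    show "(\<lambda>n. if t \<in> N then 0 else norm (f t - p (g n t))) \<longlonglongrightarrow> 0" if "t \<in> {a..b}" for t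
    proof (cases "t \<in> N")
      case False
      have "(\<lambda>n. p (g n t)) \<longlonglongrightarrow> p (f t)"
        using lim[OF False] that p(1)
        by (auto intro!: isCont_tendsto_compose[of _ p] simp: continuous_on_eq_continuous_at)
      then have "(\<lambda>n. norm (f t - p (g n t))) \<longlonglongrightarrow> norm (f t - f t)"
        unfolding p(3)[OF B(2)[OF that]] by (intro tendsto_intros)
      with False show ?thesis by simp
    qed simp
  qed
  moreover have "integral {a..b} (\<lambda>t. if t \<in> N then 0 else norm (f t - p (g n t)))
      = integral {a..b} (\<lambda>t. norm (f t - p (g n t)))" for n
    by (rule integral_spike[OF N]) auto
  ultimately have "(\<lambda>n. integral {a..b} (\<lambda>t. norm (f t - p (g n t)))) \<longlonglongrightarrow> 0" by simp
  from order_tendstoD(2)[OF this e]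
  obtain n where "integral {a..b} (\<lambda>t. norm (f t - p (g n t))) < e"
    by (auto simp: eventually_sequentially)
  with cont p(2) show ?thesis by (intro exI[of _ "\<lambda>t. p (g n t)"]) auto
qed

text \<open>If every point outside \<open>N\<close> exceeded the mean by more than \<open>d\<close>,
  so would the mean itself. The slack \<open>d\<close> makes the contradiction strict.\<close>

lemma below_average_point:
  fixes q :: "real \<Rightarrow> real"
  assumes "a < b" and q: "q integrable_on {a..b}" and N: "negligible N" and "0 < d"
  obtains t where "t \<in> {a..<b} - N" "(b - a) * q t \<le> integral {a..b} q + (b - a) * d"
proof (rule ccontr)
  note pick = that
  assume *: "\<not> thesis"
  define m where "m = integral {a..b} q / (b - a) + d"
  have m: "(b - a) * m = integral {a..b} q + (b - a) * d"
    using \<open>a < b\<close> by (simp add: m_def field_simps)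
  have less: "m < q t" if "t \<in> {a..<b} - N" for t
  proof -
    have "(b - a) * m < (b - a) * q t"
      using * pick[of t] that unfolding m by force
    then show ?thesis using \<open>a < b\<close> by simp
  qed
  define q' where "q' t = (if t \<in> insert b N then m else q t)" for t
  have N': "negligible (insert b N)" using N by simp
  have "integral {a..b} (\<lambda>t. m) \<le> integral {a..b} q'"
  proof (rule integral_le)
    show "q' integrable_on {a..b}"
      by (rule integrable_spike[OF q N']) (auto simp: q'_def)
    show "m \<le> q' t" if "t \<in> {a..b}" for t
      using less[of t] that by (auto simp: q'_def)
  qed auto
  also have "integral {a..b} q' = integral {a..b} q"
    by (rule integral_spike[OF N']) (auto simp: q'_def)
  finally have "integral {a..b} (\<lambda>t. m) \<le> integral {a..b} q" .
  moreover have "0 < (b - a) * d" using \<open>a < b\<close> \<open>0 < d\<close> by simp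
  ultimately show False using \<open>a < b\<close> m by simp
qed

section \<open>Grid cells and step functions\<close>

definition cell :: "real \<Rightarrow> nat \<Rightarrow> real \<Rightarrow> nat" where
  "cell T k t = min (k - 1) (nat \<lfloor>t / (T / real k)\<rfloor>)"

lemma grid_0 [simp]: "grid T k 0 = 0"
  by (simp add: grid_def)

lemma grid_end: "1 \<le> k \<Longrightarrow> grid T k k = T"
  by (simp add: grid_def)

lemma grid_Suc: "grid T k (Suc i) = grid T k i + T / real k"
  by (simp add: grid_def algebra_simps add_divide_distrib)

lemma grid_mono: "0 \<le> T \<Longrightarrow> i \<le> j \<Longrightarrow> grid T k i \<le> grid T k j"
  unfolding grid_def by (intro mult_right_mono) auto

lemma cell_less: "1 \<le> k \<Longrightarrow> cell T k t < k"
  by (simp add: cell_def)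

lemma cell_eq:
  assumes "0 < T" "i < k" "t \<in> {grid T k i..<grid T k (Suc i)}"
  shows "cell T k t = i"
proof -
  have "real i \<le> t / (T / real k)" "t / (T / real k) < real i + 1"
    using assms by (auto simp: grid_def field_simps)
  then have "nat \<lfloor>t / (T / real k)\<rfloor> = i" by linarith
  with assms(2) show ?thesis by (simp add: cell_def)
qed

lemma cell_bounds:
  assumes "0 < T" "1 \<le> k" "t \<in> {0..T}"
  shows "t \<in> {grid T k (cell T k t)..grid T k (Suc (cell T k t))}"
proof (cases "t = T")
  case True
  \<comment> \<open>At the endpoint the quotient equals \<open>k\<close>; the minimum in
    \<open>cell\<close> assigns this point to the last cell.\<close>
  then have "cell T k t = k - 1" using assms by (simp add: cell_def)
  moreover have "grid T k (k - 1) \<le> grid T k k" using assms by (intro grid_mono) auto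
  ultimately show ?thesis using True assms by (simp add: grid_end)
next
  case False
  define r where "r = t / (T / real k)"
  have t: "t = r * (T / real k)" using assms by (simp add: r_def)
  have r: "0 \<le> r" "r < real k" using assms False by (auto simp: r_def field_simps)
  then have "nat \<lfloor>r\<rfloor> < k" by linarith
  then have "cell T k t = nat \<lfloor>r\<rfloor>" by (simp add: cell_def r_def)
  moreover have "real (nat \<lfloor>r\<rfloor>) \<le> r" "r \<le> real (Suc (nat \<lfloor>r\<rfloor>))" using r by linarith+
  then have "grid T k (nat \<lfloor>r\<rfloor>) \<le> t" "t \<le> grid T k (Suc (nat \<lfloor>r\<rfloor>))"
    unfolding grid_def t using assms(1) by (intro mult_right_mono; simp)+
  ultimately show ?thesis by simp
qed

lemma has_integral_grid:
  fixes F :: "real \<Rightarrow> 'a::banach"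
  assumes "0 \<le> T" "\<And>i. i < m \<Longrightarrow> (F has_integral v i) {grid T k i..grid T k (Suc i)}"
  shows "(F has_integral (\<Sum>i<m. v i)) {0..grid T k m}"
  using assms(2)
proof (induction m)
  case (Suc m)
  have "(F has_integral ((\<Sum>i<m. v i) + v m)) {0..grid T k (Suc m)}"
    using assms(1) grid_mono[of T 0 m k] grid_mono[of T m "Suc m" k] Suc
    by (intro has_integral_combine[of 0 "grid T k m"]) auto
  then show ?case by simp
qed (simp add: has_integral_refl)

lemma step_has_integral_cell:
  fixes a :: "nat \<Rightarrow> 'a::banach"
  assumes "0 < T" "i < k" "grid T k i \<le> p" "p \<le> q" "q \<le> grid T k (Suc i)"
  shows "((\<lambda>t. a (cell T k t)) has_integral (q - p) *\<^sub>R a i) {p..q}"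
\<comment> \<open>The right end of a cell is already counted in the next one (except at
  \<open>T\<close>), hence one exceptional point.\<close>
proof (rule has_integral_spike_finite[of "{grid T k (Suc i)}"])
  show "((\<lambda>t. a i) has_integral (q - p) *\<^sub>R a i) {p..q}"
    using has_integral_const_real[of "a i" p q] assms by simp
  show "a (cell T k t) = a i" if "t \<in> {p..q} - {grid T k (Suc i)}" for t
    using that assms cell_eq[of T i k t] by auto
qed simp

lemma step_has_integral:
  fixes a :: "nat \<Rightarrow> 'a::banach"
  assumes "0 < T" "1 \<le> k"
  shows "((\<lambda>t. a (cell T k t)) has_integral (\<Sum>i<k. (T / real k) *\<^sub>R a i)) {0..T}"
proof -
  have "((\<lambda>t. a (cell T k t)) has_integral (\<Sum>i<k. (T / real k) *\<^sub>R a i)) {0..grid T k k}"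
  proof (rule has_integral_grid)
    show "((\<lambda>t. a (cell T k t)) has_integral (T / real k) *\<^sub>R a i)
        {grid T k i..grid T k (Suc i)}" if "i < k" for i
      using step_has_integral_cell[OF assms(1) that order_refl _ order_refl, of a] assms
      by (simp add: grid_Suc)
  qed (use assms in simp)
  with assms show ?thesis by (simp add: grid_end)
qed

lemma step_measurable:
  fixes a :: "nat \<Rightarrow> 'a::{second_countable_topology,t2_space}"
  shows "(\<lambda>t. a (cell T k t)) \<in> borel_measurable borel"
proof (rule measurable_compose[of "cell T k" _ "count_space UNIV"])
  show "cell T k \<in> borel \<rightarrow>\<^sub>M count_space UNIV"
    unfolding cell_def by measurable
qed auto

lemma step_measurable_lebesgue_on:
  fixes a :: "nat \<Rightarrow> 'a::euclidean_space"
  shows "(\<lambda>t. a (cell T k t)) \<in> borel_measurable (lebesgue_on S)"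
  by (intro measurable_restrict_space1 measurable_completion) (simp add: step_measurable)

text \<open>Replaces a diagonal argument: a choice within \<open>1 / k\<close> of the infimum of
  \<open>E k\<close> does not depend on \<open>e\<close>, yet eventually falls below every
  \<open>e\<close>.\<close>

lemma near_optimal_choice:
  fixes E :: "nat \<Rightarrow> 'a \<Rightarrow> real"
  assumes ex: "\<And>k. k \<ge> 1 \<Longrightarrow> \<exists>S. Q k S"
    and nonneg: "\<And>k S. k \<ge> 1 \<Longrightarrow> Q k S \<Longrightarrow> 0 \<le> E k S"
    and small: "\<And>e. 0 < e \<Longrightarrow> \<exists>K. \<forall>k\<ge>K. \<exists>S. Q k S \<and> E k S < e"
  obtains S where "\<And>k. k \<ge> 1 \<Longrightarrow> Q k (S k)" "(\<lambda>k. E k (S k)) \<longlonglongrightarrow> 0"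
proof -
  define m where "m k = Inf (E k ` {S. Q k S})" for k
  have m: "m k \<le> E k S" if "k \<ge> 1" "Q k S" for k S
    unfolding m_def using that nonneg by (intro cInf_lower bdd_belowI[of _ 0]) auto
  have "\<exists>S. Q k S \<and> E k S < m k + 1 / real k" if "k \<ge> 1" for k
  proof -
    have "Inf (E k ` {S. Q k S}) < m k + 1 / real k" using that by (simp add: m_def)
    from cInf_lessD[OF _ this] ex[OF that] show ?thesis by auto
  qed
  then obtain S where S: "\<And>k. k \<ge> 1 \<Longrightarrow> Q k (S k)"
    "\<And>k. k \<ge> 1 \<Longrightarrow> E k (S k) < m k + 1 / real k" by metis
  have "(\<lambda>k. E k (S k)) \<longlonglongrightarrow> 0"
  proof (rule LIMSEQ_I)
    fix e :: real assume "0 < e"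
    then obtain K where K: "\<And>k. k \<ge> K \<Longrightarrow> \<exists>S. Q k S \<and> E k S < e / 2"
      using small[of "e / 2"] by auto
    obtain M where M: "real M > 2 / e" using reals_Archimedean2 by blast
    have "norm (E k (S k) - 0) < e" if "k \<ge> max 1 (max K M)" for k
    proof -
      have k: "k \<ge> 1" "k \<ge> K" "real k > 2 / e" using that M by auto
      then have "1 / real k < e / 2" using \<open>0 < e\<close> by (simp add: field_simps)
      moreover have "m k < e / 2" using K[OF k(2)] m[OF k(1)] by force
      ultimately show ?thesis using S(2)[OF k(1)] nonneg[OF k(1) S(1)[OF k(1)]] by simp
    qed
    then show "\<exists>no. \<forall>n\<ge>no. norm (E n (S n) - 0) < e" by blast
  qed
  with S(1) that show ?thesis by blast
qed

text \<open>Compare \<open>f\<close> with a continuous \<open>\<phi>\<close> close to it in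
  \<open>L1\<close>. Uniform continuity controls \<open>\<phi>\<close> inside a cell. The remainder
  at the sampling point could be large on a small set, so the point is chosen where
  \<open>norm (f t - \<phi> t)\<close> is at most slightly above its cell average; summed over the
  cells, this costs little more than its integral.\<close>

lemma step_sampling:
  fixes f :: "real \<Rightarrow> 'a::euclidean_space"
  assumes T: "0 < T" and f: "f \<in> borel_measurable (lebesgue_on {0..T})"
    and B: "0 \<le> B" "\<And>t. t \<in> {0..T} \<Longrightarrow> norm (f t) \<le> B" and N: "negligible N"
  obtains S where
    "\<And>k i. k \<ge> 1 \<Longrightarrow> i < k \<Longrightarrow> S k i \<in> {grid T k i..<grid T k (Suc i)} - N"
    "(\<lambda>k. integral {0..T} (\<lambda>t. norm (f t - f (S k (cell T k t))))) \<longlonglongrightarrow> 0"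
proof -
  define Q where "Q k S \<longleftrightarrow> (\<forall>i<k. S i \<in> {grid T k i..<grid T k (Suc i)} - N)" for k S
  define E where "E k S = integral {0..T} (\<lambda>t. norm (f t - f (S (cell T k t))))" for k S
  have lt: "grid T k i < grid T k (Suc i)" if "k \<ge> 1" for k i
    using that T by (simp add: grid_Suc)
  have sub: "{grid T k i..grid T k (Suc i)} \<subseteq> {0..T}" if "i < k" for k i
    using grid_mono[of T 0 i k] grid_mono[of T "Suc i" k k] grid_end[of k T] that T by auto
  have ex: "\<exists>S. Q k S" if "k \<ge> 1" for k
  proof -
    have "\<exists>t. t \<in> {grid T k i..<grid T k (Suc i)} - N" for i
      by (rule below_average_point[OF lt[OF that, of i], of "\<lambda>t. 0" N 1]) (use N in auto)
    then show ?thesis unfolding Q_def by metis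
  qed
  have int: "(\<lambda>t. norm (f t - f (S (cell T k t)))) integrable_on {0..T}" if "k \<ge> 1" "Q k S" for k S
  proof (rule measurable_bounded_by_integrable_imp_integrable)
    have "(\<lambda>t. f (S (cell T k t))) \<in> borel_measurable (lebesgue_on {0..T})"
      by (rule step_measurable_lebesgue_on)
    with f show "(\<lambda>t. norm (f t - f (S (cell T k t)))) \<in> borel_measurable (lebesgue_on {0..T})"
      by (intro measurable_compose[OF _ borel_measurable_norm] borel_measurable_diff)
    show "norm (norm (f t - f (S (cell T k t)))) \<le> 2 * B" if t: "t \<in> {0..T}" for t
    proof -
      define c where "c = cell T k t"
      have c: "c < k" using cell_less[OF \<open>k \<ge> 1\<close>] by (simp add: c_def)
      then have "S c \<in> {grid T k c..<grid T k (Suc c)}" using \<open>Q k S\<close> by (auto simp: Q_def)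
      then have "S c \<in> {0..T}" using sub[OF c] by auto
      from B(2)[OF this] B(2)[OF t] show ?thesis
        using norm_triangle_ineq4[of "f t" "f (S c)"] by (simp add: c_def)
    qed
  qed auto
  have "\<exists>K. \<forall>k\<ge>K. \<exists>S. Q k S \<and> E k S < e" if "0 < e" for e
  proof -
    \<comment> \<open>The estimate below gives \<open>E k S\<close> at most twice the integral of
      \<open>q\<close> plus \<open>2 * (T * d)\<close>, which is less than
      \<open>2 * d + 2 * (T * d) = e / 2\<close>.\<close>
    define d where "d = e / (4 + 4 * T)"
    have d: "0 < d" using that T by (simp add: d_def)
    have "d * (4 + 4 * T) = e" using T by (simp add: d_def)
    then have de: "4 * d + 4 * (T * d) = e" by (simp add: algebra_simps)
    obtain \<phi> where \<phi>: "continuous_on UNIV \<phi>" "\<And>t. norm (\<phi> t) \<le> B"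
      "integral {0..T} (\<lambda>t. norm (f t - \<phi> t)) < d"
      using bounded_measurable_L1_approx[OF f B d] by auto
    define q where "q t = norm (f t - \<phi> t)" for t
    have q: "q integrable_on {0..T}"
      unfolding q_def
    proof (rule measurable_bounded_by_integrable_imp_integrable)
      have "\<phi> \<in> borel_measurable (lebesgue_on {0..T})"
        by (intro continuous_imp_measurable_on_sets_lebesgue continuous_on_subset[OF \<phi>(1)]) auto
      with f show "(\<lambda>t. norm (f t - \<phi> t)) \<in> borel_measurable (lebesgue_on {0..T})"
        by measurable
      show "norm (norm (f t - \<phi> t)) \<le> 2 * B" if "t \<in> {0..T}" for t
        using B(2)[OF that] \<phi>(2)[of t] norm_triangle_ineq4[of "f t" "\<phi> t"] by simp
    qed auto
    have "uniformly_continuous_on {0..T} \<phi>"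
      by (intro compact_uniformly_continuous continuous_on_subset[OF \<phi>(1)]) auto
    then obtain r where r: "0 < r"
      "\<And>t t'. t \<in> {0..T} \<Longrightarrow> t' \<in> {0..T} \<Longrightarrow> dist t' t < r \<Longrightarrow> dist (\<phi> t') (\<phi> t) < d"
      using d unfolding uniformly_continuous_on_def by meson
    obtain K where K: "real K > T / r" using reals_Archimedean2 by blast
    have "\<exists>S. Q k S \<and> E k S < e" if "k \<ge> max 1 K" for k
    proof -
      define h where "h = T / real k"
      have k: "k \<ge> 1" "real k > T / r" using that K by auto
      then have h: "0 < h" "h < r" using T r(1) by (auto simp: h_def field_simps)
      have qi: "q integrable_on {grid T k i..grid T k (Suc i)}" if "i < k" for i
        by (rule integrable_subinterval_real[OF q sub[OF that]])
      have "\<exists>t. t \<in> {grid T k i..<grid T k (Suc i)} - N \<and>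
          h * q t \<le> integral {grid T k i..grid T k (Suc i)} q + h * d" if "i < k" for i
        by (rule below_average_point[OF lt[OF k(1)] qi[OF that] N d])
          (auto simp: grid_Suc h_def)
      then obtain S where S: "\<And>i. i < k \<Longrightarrow> S i \<in> {grid T k i..<grid T k (Suc i)} - N"
        "\<And>i. i < k \<Longrightarrow> h * q (S i) \<le> integral {grid T k i..grid T k (Suc i)} q + h * d"
        by metis
      have QS: "Q k S" using S(1) by (simp add: Q_def)
      define I where "I i = integral {grid T k i..grid T k (Suc i)} q" for i
      have "(q has_integral (\<Sum>i<k. I i)) {0..grid T k k}"
        unfolding I_def
        by (rule has_integral_grid) (use T integrable_integral[OF qi] in auto)
      then have I: "(\<Sum>i<k. I i) = integral {0..T} q"
        using k(1) by (simp add: grid_end integral_unique)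
      have step: "((\<lambda>t. q (S (cell T k t))) has_integral (\<Sum>i<k. h * q (S i))) {0..T}"
        using step_has_integral[OF T k(1), of "\<lambda>i. q (S i)"] by (simp add: h_def)
      have "((\<lambda>t. d) has_integral T * d) {0..T}"
        using has_integral_const_real[of d 0 T] T by simp
      then have bound: "((\<lambda>t. (q t + d) + q (S (cell T k t))) has_integral
          (integral {0..T} q + T * d) + (\<Sum>i<k. h * q (S i))) {0..T}"
        by (intro has_integral_add integrable_integral[OF q] step)
      have "E k S \<le> integral {0..T} (\<lambda>t. (q t + d) + q (S (cell T k t)))"
        unfolding E_def
      proof (rule integral_le[OF int[OF k(1) QS]])
        show "(\<lambda>t. (q t + d) + q (S (cell T k t))) integrable_on {0..T}"
          using bound by blast
        fix t assume t: "t \<in> {0..T}"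
        define c where "c = cell T k t"
        have c: "c < k" using cell_less[OF k(1)] by (simp add: c_def)
        have "t \<in> {grid T k c..grid T k (Suc c)}" using cell_bounds[OF T k(1) t] by (simp add: c_def)
        then have "dist t (S c) < r" and "S c \<in> {0..T}"
          using S(1)[OF c] sub[OF c] h by (auto simp: dist_real_def grid_Suc h_def[symmetric])
        with r(2) t have "norm (\<phi> t - \<phi> (S c)) < d" by (simp add: dist_norm)
        moreover have "norm (f t - f (S c)) \<le> q t + norm (\<phi> t - \<phi> (S c)) + q (S c)"
          using norm_triangle_ineq[of "f t - \<phi> t" "\<phi> t - f (S c)"]
            norm_triangle_ineq4[of "\<phi> t - \<phi> (S c)" "f (S c) - \<phi> (S c)"]
          by (simp add: q_def)
        ultimately show "norm (f t - f (S (cell T k t))) \<le> (q t + d) + q (S (cell T k t))"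
          by (simp add: c_def)
      qed
      also have "\<dots> = (integral {0..T} q + T * d) + (\<Sum>i<k. h * q (S i))"
        by (rule integral_unique[OF bound])
      also have "(\<Sum>i<k. h * q (S i)) \<le> (\<Sum>i<k. I i + h * d)"
        using S(2) by (intro sum_mono) (auto simp: I_def)
      also have "\<dots> = integral {0..T} q + T * d"
        using k(1) by (simp add: sum.distrib I h_def)
      finally have "E k S \<le> 2 * (integral {0..T} q) + 2 * (T * d)" by simp
      moreover have "integral {0..T} q < d" using \<phi>(3) by (simp add: q_def[abs_def])
      ultimately have "E k S < e" using de d mult_pos_pos[OF T d] by linarith
      with QS show ?thesis by blast
    qed
    then show ?thesis by blast
  qed
  moreover have "0 \<le> E k S" if "k \<ge> 1" "Q k S" for k S
    unfolding E_def by (intro integral_nonneg int that) auto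
  ultimately obtain S where "\<And>k. k \<ge> 1 \<Longrightarrow> Q k (S k)" "(\<lambda>k. E k (S k)) \<longlonglongrightarrow> 0"
    using near_optimal_choice[of Q E] ex by blast
  then show ?thesis using that[of S] by (auto simp: Q_def E_def)
qed

subsection \<open>Normal cones of perturbed polyhedra\<close>

lemma mem_poly_set: "x \<in> poly_set s a b \<longleftrightarrow> (\<forall>j\<in>{1..s}. a j \<bullet> x \<le> b j)"
  by (auto simp: poly_set_def)

lemma normal_coneD: "v \<in> normal_cone x C \<Longrightarrow> x \<in> C \<and> (\<forall>y\<in>C. v \<bullet> (y - x) \<le> 0)"
  by (simp add: normal_cone_def split: if_splits)

text \<open>A strict Slater point for one time stays strict, with a positive margin, for all nearby
  times in \<open>K\<close>. A finite subcover leaves finitely many points and margins, whose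
  largest norm and smallest margin are \<open>R\<close> and \<open>\<eta>\<close>.\<close>

lemma uniform_slater:
  fixes a :: "nat \<Rightarrow> real \<Rightarrow> 'a::euclidean_space"
  assumes K: "compact K" and a: "\<And>j. j \<in> {1..s} \<Longrightarrow> continuous_on K (a j)"
    and b: "\<And>j. j \<in> {1..s} \<Longrightarrow> continuous_on K (b j)"
    and slater: "\<And>t. t \<in> K \<Longrightarrow> \<exists>z. \<forall>j\<in>{1..s}. a j t \<bullet> z < b j t"
  obtains \<eta> R where "0 < \<eta>" "0 \<le> R"
    "\<And>t. t \<in> K \<Longrightarrow> \<exists>z. norm z \<le> R \<and> (\<forall>j\<in>{1..s}. a j t \<bullet> z \<le> b j t - \<eta>)"
proof -
  obtain z where z: "\<And>t j. t \<in> K \<Longrightarrow> j \<in> {1..s} \<Longrightarrow> a j t \<bullet> z t < b j t"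
    using slater by metis
  define V where "V t r = {t' \<in> K. \<forall>j\<in>{1..s}. r < b j t' - a j t' \<bullet> z t}" for t r
  have V: "openin (top_of_set K) (V t r)" for t r
  proof -
    have *: "openin (top_of_set K) (K \<inter> (\<lambda>t'. b j t' - a j t' \<bullet> z t) -` {r<..})"
      if "j \<in> {1..s}" for j
      using a[OF that] b[OF that]
      by (intro continuous_openin_preimage_gen) (auto intro!: continuous_intros)
    \<comment> \<open>Without constraints the intersection over \<open>j\<close> would be
      \<open>UNIV\<close> instead of \<open>K\<close>.\<close>
    show ?thesis
    proof (cases "s = 0")
      case False
      then have "V t r = (\<Inter>j\<in>{1..s}. K \<inter> (\<lambda>t'. b j t' - a j t' \<bullet> z t) -` {r<..})"
        by (auto simp: V_def)
      also have "openin (top_of_set K) \<dots>"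
        using False * by (intro openin_INT2) auto
      finally show ?thesis .
    qed (simp add: V_def)
  qed
  have "\<exists>r. 0 < r \<and> t \<in> V t r" if "t \<in> K" for t
  proof -
    \<comment> \<open>Inserting 1 keeps the minimum defined when there are no constraints; below,
      the inserted 1 and 0 do the same for an empty cover.\<close>
    define m where "m = Min (insert 1 ((\<lambda>j. b j t - a j t \<bullet> z t) ` {1..s}))"
    have "0 < m" unfolding m_def using z[OF that] by (subst Min_gr_iff) auto
    moreover have "m \<le> b j t - a j t \<bullet> z t" if "j \<in> {1..s}" for j
      unfolding m_def using that by (intro Min_le) auto
    ultimately show ?thesis using that
      by (intro exI[of _ "m / 2"]) (fastforce simp: V_def)
  qed
  then obtain r where r: "\<And>t. t \<in> K \<Longrightarrow> 0 < r t \<and> t \<in> V t (r t)" by metis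
  have "K \<subseteq> (\<Union>t\<in>K. V t (r t))" using r by auto
  moreover have "\<forall>W\<in>(\<lambda>t. V t (r t)) ` K. openin (top_of_set K) W" using V by auto
  ultimately obtain D where D: "D \<subseteq> (\<lambda>t. V t (r t)) ` K" "finite D" "K \<subseteq> \<Union> D"
    using K unfolding compact_eq_openin_cover by meson
  from finite_subset_image[OF D(2,1)] D(3)
  obtain F where F: "F \<subseteq> K" "finite F" "K \<subseteq> (\<Union>t\<in>F. V t (r t))" by blast
  define \<eta> where "\<eta> = Min (insert 1 (r ` F))"
  define R where "R = Max (insert 0 ((\<lambda>t. norm (z t)) ` F))"
  show ?thesis
  proof (rule that[of \<eta> R])
    show "0 < \<eta>" unfolding \<eta>_def using F r by (subst Min_gr_iff) auto
    show "0 \<le> R" unfolding R_def using F by (intro Max_ge) auto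
    fix t assume "t \<in> K"
    then obtain t' where t': "t' \<in> F" "t \<in> V t' (r t')" using F(3) by auto
    have "\<eta> \<le> r t'" unfolding \<eta>_def using F t' by (intro Min_le) auto
    moreover have "norm (z t') \<le> R" unfolding R_def using F t' by (intro Max_ge) auto
    ultimately show "\<exists>z. norm z \<le> R \<and> (\<forall>j\<in>{1..s}. a j t \<bullet> z \<le> b j t - \<eta>)"
    proof (intro exI[of _ "z t'"] conjI ballI)
      fix j assume "j \<in> {1..s}"
      with t'(2) have "r t' < b j t - a j t \<bullet> z t'" by (simp add: V_def)
      with \<open>\<eta> \<le> r t'\<close> show "a j t \<bullet> z t' \<le> b j t - \<eta>" by simp
    qed
  qed
qed

text \<open>\<open>y\<close> violates each constraint \<open>a j\<close>, \<open>b j\<close> by at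
  most \<open>d * (1 + norm y)\<close>. The convex combination
  \<open>y' = (y + \<theta> z) / (1 + \<theta>)\<close> repairs this, because \<open>z\<close> has
  slack \<open>\<eta>\<close> and \<open>\<theta> * \<eta>\<close> equals that violation. Testing
  \<open>v\<close> with \<open>y'\<close> then costs only the displacement from \<open>y\<close> to
  \<open>y'\<close>.\<close>

lemma normal_cone_nearby_point:
  assumes v: "v \<in> normal_cone x (poly_set s a b)" and y: "y \<in> poly_set s a' b'"
    and a: "\<And>j. j \<in> {1..s} \<Longrightarrow> norm (a j - a' j) \<le> d"
    and b: "\<And>j. j \<in> {1..s} \<Longrightarrow> \<bar>b j - b' j\<bar> \<le> d"
    and z: "\<And>j. j \<in> {1..s} \<Longrightarrow> a j \<bullet> z \<le> b j - \<eta>" and "0 < \<eta>" "0 \<le> d"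
  shows "v \<bullet> (y - x) \<le> norm v * (d * (1 + norm y) / \<eta>) * norm (z - y)"
proof -
  define \<theta> where "\<theta> = d * (1 + norm y) / \<eta>"
  have \<theta>: "0 \<le> \<theta>" "\<theta> * \<eta> = d * (1 + norm y)" using assms(6,7) by (auto simp: \<theta>_def)
  define y' where "y' = y + (\<theta> / (1 + \<theta>)) *\<^sub>R (z - y)"
  have "y' \<in> poly_set s a b"
    unfolding mem_poly_set
  proof
    fix j assume j: "j \<in> {1..s}"
    have "a j \<bullet> y = a' j \<bullet> y + (a j - a' j) \<bullet> y" by (simp add: inner_diff_left)
    also have "\<dots> \<le> b' j + d * norm y"
      using y j a[OF j] norm_cauchy_schwarz[of "a j - a' j" y] mult_right_mono[OF a[OF j], of "norm y"]
      by (intro add_mono) (auto simp: mem_poly_set)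
    also have "\<dots> \<le> b j + \<theta> * \<eta>" using b[OF j] unfolding \<theta>(2) by (simp add: algebra_simps)
    finally have "a j \<bullet> y + \<theta> * (a j \<bullet> z) \<le> (b j + \<theta> * \<eta>) + \<theta> * (b j - \<eta>)"
      using z[OF j] \<theta>(1) by (intro add_mono mult_left_mono) auto
    also have "\<dots> = (1 + \<theta>) * b j" by (simp add: algebra_simps)
    also have "a j \<bullet> y + \<theta> * (a j \<bullet> z) = (1 + \<theta>) * (a j \<bullet> y')"
    proof -
      have "(1 + \<theta>) *\<^sub>R y' = y + \<theta> *\<^sub>R z"
        using \<theta>(1) by (simp add: y'_def scaleR_add_right) (simp add: algebra_simps)
      then show ?thesis by (metis inner_add_right inner_scaleR_right)
    qed
    finally show "a j \<bullet> y' \<le> b j" using \<theta>(1) by (simp add: mult_le_cancel_left)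
  qed
  then have "v \<bullet> (y' - x) \<le> 0" using normal_coneD[OF v] by blast
  then have "v \<bullet> (y - x) \<le> - (v \<bullet> ((\<theta> / (1 + \<theta>)) *\<^sub>R (z - y)))"
    by (simp add: y'_def inner_add_right inner_diff_right algebra_simps)
  also have "\<dots> \<le> norm v * norm ((\<theta> / (1 + \<theta>)) *\<^sub>R (z - y))"
    by (metis norm_cauchy_schwarz inner_minus_left norm_minus_cancel)
  also have "\<dots> \<le> norm v * (\<theta> * norm (z - y))"
  proof (rule mult_left_mono)
    have "\<theta> / (1 + \<theta>) \<le> \<theta>" using \<theta>(1) by (simp add: divide_le_eq algebra_simps)
    then show "norm ((\<theta> / (1 + \<theta>)) *\<^sub>R (z - y)) \<le> \<theta> * norm (z - y)"
      using \<theta>(1) unfolding norm_scaleR by (intro mult_right_mono) auto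
  qed simp
  finally show ?thesis by (simp add: \<theta>_def)
qed

text \<open>Active constraints survive any step along \<open>d\<close>; an inactive one limits the
  step only to a positive length, and there are finitely many. Thus a condition on active
  constraints alone yields an actual point of the set, against which a normal vector can be
  tested.\<close>

lemma polyhedral_feasible_direction:
  assumes x: "x \<in> poly_set s a b"
    and d: "\<And>j. j \<in> {1..s} \<Longrightarrow> a j \<bullet> x = b j \<Longrightarrow> a j \<bullet> d \<le> 0"
  obtains e where "0 < e" "x + e *\<^sub>R d \<in> poly_set s a b"
proof -
  have "\<exists>e>0. \<forall>j\<in>J. a j \<bullet> x + e * (a j \<bullet> d) \<le> b j" if "finite J" "J \<subseteq> {1..s}" for J
    using that
  proof (induction J rule: finite_induct)
    case (insert i J)
    then obtain e where e: "0 < e" "\<And>j. j \<in> J \<Longrightarrow> a j \<bullet> x + e * (a j \<bullet> d) \<le> b j" by auto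
    have xi: "a i \<bullet> x \<le> b i" and xJ: "\<And>j. j \<in> J \<Longrightarrow> a j \<bullet> x \<le> b j"
      using x insert.prems by (auto simp: mem_poly_set)
    \<comment> \<open>\<open>x\<close> satisfies the constraint too, so satisfaction at step
      \<open>e\<close> passes to all shorter steps; this lets the induction shrink the step.\<close>
    have smaller: "a j \<bullet> x + e' * (a j \<bullet> d) \<le> b j" if "j \<in> J" "0 < e'" "e' \<le> e" for e' j
    proof (cases "a j \<bullet> d \<le> 0")
      case True
      then have "e' * (a j \<bullet> d) \<le> 0" using that(2) by (simp add: mult_nonneg_nonpos)
      then show ?thesis using xJ[OF that(1)] by linarith
    next
      case False
      then have "e' * (a j \<bullet> d) \<le> e * (a j \<bullet> d)" using that by (intro mult_right_mono) auto
      then show ?thesis using e(2)[OF that(1)] by linarith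
    qed
    show ?case
    proof (cases "a i \<bullet> d \<le> 0")
      case True
      then have "e * (a i \<bullet> d) \<le> 0" using e(1) by (simp add: mult_nonneg_nonpos)
      then show ?thesis using e xi by (intro exI[of _ e]) auto
    next
      case False
      then have "a i \<bullet> x < b i" using d[of i] insert.prems xi by force
      define e' where "e' = min e ((b i - a i \<bullet> x) / (a i \<bullet> d))"
      have e': "0 < e'" "e' \<le> e" using e(1) False \<open>a i \<bullet> x < b i\<close> by (auto simp: e'_def)
      have "e' \<le> (b i - a i \<bullet> x) / (a i \<bullet> d)" by (simp add: e'_def)
      then have "e' * (a i \<bullet> d) \<le> b i - a i \<bullet> x" using False by (simp add: field_simps)
      with e' smaller show ?thesis by (intro exI[of _ e']) auto
    qed
  qed (auto intro: exI[of _ 1])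
  from this[of "{1..s}"] obtain e where "0 < e" "\<forall>j\<in>{1..s}. a j \<bullet> x + e * (a j \<bullet> d) \<le> b j" by auto
  then show ?thesis by (intro that[of e]) (auto simp: mem_poly_set inner_add_right)
qed

text \<open>The perturbation \<open>p\<close> is the projection of \<open>v\<close> onto the cone tangent to the new polyhedron
  along the active constraints, so that \<open>v - p\<close> lies in its polar; a Slater point turns \<open>p\<close> into
  a feasible direction of the old polyhedron, which bounds \<open>v \<bullet> p = (norm p)\<^sup>2\<close>. This avoids
  Farkas multipliers.\<close>

lemma normal_cone_poly_perturb:
  fixes a a' :: "nat \<Rightarrow> 'a::euclidean_space"
  assumes v: "v \<in> normal_cone x (poly_set s a b)"
    and a: "\<And>j. j \<in> {1..s} \<Longrightarrow> norm (a j - a' j) \<le> d"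
    and z: "\<And>j. j \<in> {1..s} \<Longrightarrow> a j \<bullet> z \<le> b j - \<eta>" and "0 < \<eta>" "0 \<le> d"
    and x': "x' \<in> poly_set s a' b'"
    and active: "\<And>j. j \<in> {1..s} \<Longrightarrow> a j \<bullet> x = b j \<Longrightarrow> a' j \<bullet> x' = b' j"
  obtains p where "norm p \<le> norm v * (d / \<eta>) * norm (z - x)"
    "v - p \<in> normal_cone x' (poly_set s a' b')"
proof -
  define K where "K = {y. \<forall>j\<in>{1..s}. a j \<bullet> x = b j \<longrightarrow> a' j \<bullet> y \<le> 0}"
  have "K = (\<Inter>j\<in>{j\<in>{1..s}. a j \<bullet> x = b j}. {y. a' j \<bullet> y \<le> 0})" by (auto simp: K_def)
  then have K: "convex K" "closed K" "0 \<in> K"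
    by (auto intro!: convex_INT closed_INT convex_halfspace_le closed_halfspace_le simp: K_def)
  define p where "p = closest_point K v"
  have p: "p \<in> K" using closest_point_in_set[of K v] K by (auto simp: p_def)
  have dot: "(v - p) \<bullet> (y - p) \<le> 0" if "y \<in> K" for y
    unfolding p_def by (rule closest_point_dot[OF K(1,2) that])
  \<comment> \<open>Testing the projection inequality with \<open>0\<close> and with
    \<open>2 *\<^sub>R p\<close> gives both signs, hence orthogonality (Moreau decomposition for the
    cone \<open>K\<close>).\<close>
  have "2 *\<^sub>R p \<in> K" using p by (auto simp: K_def)
  from dot[OF this] dot[OF K(3)] have vp: "(v - p) \<bullet> p = 0"
    by (simp add: inner_diff_right algebra_simps)
  have polar: "(v - p) \<bullet> y \<le> 0" if "y \<in> K" for y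
    using dot[OF that] vp by (simp add: inner_diff_right)
  have x: "x \<in> poly_set s a b" using normal_coneD[OF v] by blast
  \<comment> \<open>On an active constraint \<open>a' j \<bullet> p\<close> is nonpositive, so
    \<open>a j \<bullet> p\<close> is at most \<open>d * norm p\<close>. Each unit of
    \<open>z - x\<close> lowers the product by at least \<open>\<eta>\<close>, which fixes the
    coefficient.\<close>
  define w where "w = p + (d * norm p / \<eta>) *\<^sub>R (z - x)"
  have "a j \<bullet> w \<le> 0" if j: "j \<in> {1..s}" "a j \<bullet> x = b j" for j
  proof -
    have "a j \<bullet> p = a' j \<bullet> p + (a j - a' j) \<bullet> p" by (simp add: inner_diff_left)
    also have "\<dots> \<le> 0 + d * norm p"
      using p j norm_cauchy_schwarz[of "a j - a' j" p] mult_right_mono[OF a[OF j(1)], of "norm p"]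
      by (intro add_mono) (auto simp: K_def)
    finally have 1: "a j \<bullet> p \<le> d * norm p" by simp
    have "a j \<bullet> (z - x) \<le> - \<eta>" using z[OF j(1)] j(2) by (simp add: inner_diff_right)
    then have "(d * norm p / \<eta>) * (a j \<bullet> (z - x)) \<le> (d * norm p / \<eta>) * (- \<eta>)"
      using assms(4,5) by (intro mult_left_mono) auto
    with 1 show ?thesis using assms(4) by (simp add: w_def inner_add_right)
  qed
  then obtain e where "0 < e" "x + e *\<^sub>R w \<in> poly_set s a b"
    using polyhedral_feasible_direction[OF x, of w] by blast
  then have "v \<bullet> w \<le> 0"
    using normal_coneD[OF v] by (fastforce simp: mult_le_0_iff)
  moreover have "v \<bullet> p = norm p * norm p" using vp
    by (simp add: inner_diff_left flip: power2_eq_square dot_square_norm)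
  ultimately have "norm p * norm p \<le> - ((d * norm p / \<eta>) * (v \<bullet> (z - x)))"
    by (simp add: w_def inner_add_right)
  also have "\<dots> = (d * norm p / \<eta>) * (- v \<bullet> (z - x))" by simp
  also have "\<dots> \<le> (d * norm p / \<eta>) * (norm v * norm (z - x))"
    using assms(4,5) norm_cauchy_schwarz[of "- v" "z - x"] by (intro mult_left_mono) auto
  also have "\<dots> = norm p * (norm v * (d / \<eta>) * norm (z - x))" by simp
  finally have "norm p * norm p \<le> norm p * (norm v * (d / \<eta>) * norm (z - x))" .
  then have "norm p \<le> norm v * (d / \<eta>) * norm (z - x)"
  proof (cases "p = 0")
    case False
    then show ?thesis
      using \<open>norm p * norm p \<le> norm p * _\<close> by (meson mult_left_le_imp_le zero_less_norm_iff)
  qed (use assms(4,5) in simp)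
  moreover have "v - p \<in> normal_cone x' (poly_set s a' b')"
  proof -
    \<comment> \<open>The constraints defining \<open>K\<close> are tight at \<open>x'\<close> by
      \<open>active\<close>, so differences from \<open>x'\<close> lie in \<open>K\<close> and its
      polar consists of normals at \<open>x'\<close>.\<close>
    have "y - x' \<in> K" if "y \<in> poly_set s a' b'" for y
      using that active by (auto simp: K_def mem_poly_set inner_diff_right)
    with x' polar show ?thesis by (auto simp: normal_cone_def)
  qed
  ultimately show ?thesis by (rule that)
qed

subsection \<open>Absolutely continuous functions and primitives of step functions\<close>

lemma set_borel_measurable_lebesgue_on:
  fixes f :: "real \<Rightarrow> 'a::euclidean_space"
  assumes "A \<in> sets lebesgue"
  shows "set_borel_measurable lebesgue A f \<longleftrightarrow> f \<in> borel_measurable (lebesgue_on A)"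
  using assms by (simp add: set_borel_measurable_def borel_measurable_restrict_space_iff)

lemma AE_lebesgue_on_interval:
  assumes "negligible N" "\<And>t. t \<in> A - N \<Longrightarrow> P t"
  shows "AE t in lebesgue. t \<in> A \<longrightarrow> P t"
  using assms unfolding eventually_ae_filter_negligible by blast

text \<open>The squared norm is at most \<open>B\<close> times the norm, so for bounded functions
  smallness in \<open>L1\<close> gives smallness in \<open>L2\<close>; sampling in \<open>L1\<close>
  is therefore enough.\<close>

lemma bounded_measurable_L2:
  fixes f :: "real \<Rightarrow> 'a::euclidean_space"
  assumes f: "f \<in> borel_measurable (lebesgue_on {0..T})"
    and N: "negligible N" and B: "\<And>t. t \<in> {0..T} - N \<Longrightarrow> norm (f t) \<le> B"
  shows "L2_on T f" and "f absolutely_integrable_on {0..T}"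
    and "L2_norm T f \<le> sqrt (B * integral {0..T} (\<lambda>t. norm (f t)))"
proof -
  have nf: "(\<lambda>t. norm (f t)) \<in> borel_measurable (lebesgue_on {0..T})"
    "(\<lambda>t. (norm (f t))\<^sup>2) \<in> borel_measurable (lebesgue_on {0..T})"
    using f by measurable
  have const: "set_integrable lebesgue {0..T} (\<lambda>t. c)" for c :: real
    by (rule absolutely_integrable_on_const) simp
  show fi: "f absolutely_integrable_on {0..T}"
  proof (rule set_integrable_bound[OF const[of B]])
    show "set_borel_measurable lebesgue {0..T} f"
      using f by (simp add: set_borel_measurable_lebesgue_on)
    show "AE t in lebesgue. t \<in> {0..T} \<longrightarrow> norm (f t) \<le> norm B"
      by (rule AE_lebesgue_on_interval[OF N]) (use B in fastforce)
  qed
  have sq: "set_integrable lebesgue {0..T} (\<lambda>t. (norm (f t))\<^sup>2)"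
  proof (rule set_integrable_bound[OF const[of "B\<^sup>2"]])
    show "set_borel_measurable lebesgue {0..T} (\<lambda>t. (norm (f t))\<^sup>2)"
      using nf by (simp add: set_borel_measurable_lebesgue_on)
    show "AE t in lebesgue. t \<in> {0..T} \<longrightarrow> norm ((norm (f t))\<^sup>2) \<le> norm (B\<^sup>2)"
      by (rule AE_lebesgue_on_interval[OF N]) (use B in \<open>auto intro!: power_mono\<close>)
  qed
  then show "L2_on T f"
    using f by (simp add: L2_on_def set_borel_measurable_lebesgue_on)
  have Bf: "set_integrable lebesgue {0..T} (\<lambda>t. B * norm (f t))"
    using set_integrable_norm[OF fi] by simp
  have "(LINT t:{0..T}|lebesgue. (norm (f t))\<^sup>2) \<le> (LINT t:{0..T}|lebesgue. B * norm (f t))"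
  proof (rule set_integral_mono_AE[OF sq Bf])
    show "AE t \<in> {0..T} in lebesgue. (norm (f t))\<^sup>2 \<le> B * norm (f t)"
      by (rule AE_lebesgue_on_interval[OF N])
        (use B in \<open>auto simp: power2_eq_square intro!: mult_right_mono\<close>)
  qed
  also have "\<dots> = B * integral {0..T} (\<lambda>t. norm (f t))"
    using set_lebesgue_integral_eq_integral(2)[OF Bf] by simp
  finally show "L2_norm T f \<le> sqrt (B * integral {0..T} (\<lambda>t. norm (f t)))"
    by (simp add: L2_norm_def)
qed

lemma abs_cont_on_increment:
  assumes x: "abs_cont_on T x" and pq: "0 \<le> p" "p \<le> q" "q \<le> T"
  shows "x q - x p = integral {p..q} (velocity T x)" "velocity T x integrable_on {p..q}"
proof -
  have vi: "set_integrable lebesgue {0..r} (velocity T x)" if "r \<le> T" for r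
  proof (rule set_integrable_subset)
    show "set_integrable lebesgue {0..T} (velocity T x)" using x unfolding abs_cont_on_def by blast
  qed (use that in auto)
  have "\<forall>r\<in>{0..T}. x r = x 0 + (LINT r:{0..r}|lebesgue. velocity T x r)"
    using x unfolding abs_cont_on_def by blast
  then have eq: "x r = x 0 + integral {0..r} (velocity T x)" if "0 \<le> r" "r \<le> T" for r
    using that unfolding set_lebesgue_integral_eq_integral(2)[OF vi[OF that(2)], symmetric] by (meson atLeastAtMost_iff)
  have int: "velocity T x integrable_on {0..q}"
    using set_lebesgue_integral_eq_integral(1)[OF vi[OF pq(3)]] .
  show "x q - x p = integral {p..q} (velocity T x)"
    using Henstock_Kurzweil_Integration.integral_combine[OF pq(1,2) int] eq[of p] eq[of q] pq
    by (simp add: algebra_simps)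
  show "velocity T x integrable_on {p..q}"
    by (rule integrable_subinterval_real[OF int]) (use pq in auto)
qed

lemma abs_cont_on_imp_continuous_on:
  assumes x: "abs_cont_on T x"
  shows "continuous_on {0..T} x"
proof (cases "0 \<le> T")
  case True
  have "continuous_on {0..T} (\<lambda>t. x 0 + integral {0..t} (velocity T x))"
    using abs_cont_on_increment(2)[OF x, of 0 T] True
    by (intro continuous_intros indefinite_integral_continuous_1) auto
  moreover have "x t = x 0 + integral {0..t} (velocity T x)" if "t \<in> {0..T}" for t
    using abs_cont_on_increment(1)[OF x, of 0 t] that by (simp add: algebra_simps)
  ultimately show ?thesis by (metis (no_types, lifting) continuous_on_cong)
qed simp

lemma abs_cont_on_lipschitz:
  fixes x :: "real \<Rightarrow> 'a::euclidean_space"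
  assumes x: "abs_cont_on T x" and N: "negligible N" and "0 \<le> K"
    and K: "\<And>t. t \<in> {0..T} - N \<Longrightarrow> norm (velocity T x t) \<le> K"
  shows "K-lipschitz_on {0..T} x"
proof -
  have *: "norm (x q - x p) \<le> K * (q - p)" if "0 \<le> p" "p \<le> q" "q \<le> T" for p q
  proof -
    \<comment> \<open>\<open>has_integral_bound\<close> needs the bound at every point, so the
      velocity is set to zero on the null set.\<close>
    define v where "v t = (if t \<in> N then 0 else velocity T x t)" for t
    have "(velocity T x has_integral x q - x p) {p..q}"
      using abs_cont_on_increment[OF x that] by (simp add: integrable_integral)
    then have "(v has_integral x q - x p) {p..q}"
      by (rule has_integral_spike[OF N, rotated]) (simp add: v_def)
    then show ?thesis
      using has_integral_bound[of K v "x q - x p" p q] K that \<open>0 \<le> K\<close> by (auto simp: v_def)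
  qed
  show ?thesis
  proof (rule lipschitz_onI)
    show "dist (x p) (x q) \<le> K * dist p q" if "p \<in> {0..T}" "q \<in> {0..T}" for p q
      using *[of p q] *[of q p] that
      by (cases "p \<le> q") (auto simp: dist_norm norm_minus_commute)
  qed fact
qed

section \<open>Difference quotients and pointwise velocity bounds\<close>

lemma has_vector_derivative_quotient:
  assumes "(x has_vector_derivative w) (at t within S)"
  shows "((\<lambda>r. (x r - x t) /\<^sub>R (r - t)) \<longlongrightarrow> w) (at t within S)"
proof (rule Lim_null[THEN iffD2], rule tendsto_norm_zero_cancel)
  have "((\<lambda>r. norm ((x r - x t) - (r - t) *\<^sub>R w) / norm (r - t)) \<longlongrightarrow> 0) (at t within S)"
    using assms by (simp add: has_vector_derivative_def has_derivative_iff_norm)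
  moreover have "norm ((x r - x t) - (r - t) *\<^sub>R w) / norm (r - t) = norm ((x r - x t) /\<^sub>R (r - t) - w)"
    if "r \<noteq> t" for r
  proof -
    have "(x r - x t) /\<^sub>R (r - t) - w = ((x r - x t) - (r - t) *\<^sub>R w) /\<^sub>R (r - t)"
      using that by (simp add: scaleR_diff_right)
    then show ?thesis by (simp add: divide_inverse_commute)
  qed
  then have "\<forall>\<^sub>F r in at t within S. norm ((x r - x t) - (r - t) *\<^sub>R w) / norm (r - t) =
      norm ((x r - x t) /\<^sub>R (r - t) - w)"
    by (auto simp: eventually_at_filter)
  ultimately show "((\<lambda>r. norm ((x r - x t) /\<^sub>R (r - t) - w)) \<longlongrightarrow> 0) (at t within S)"
    by (rule Lim_transform_eventually)
qed

lemma lipschitz_on_derivative_bound: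
  fixes x :: "real \<Rightarrow> 'a::real_normed_vector"
  assumes L: "L-lipschitz_on {0..T} x" and T: "0 < T" and t: "t \<in> {0..T}"
    and x: "(x has_vector_derivative w) (at t within {0..T})"
  shows "norm w \<le> L"
proof (rule tendsto_upperbound)
  show "((\<lambda>r. norm ((x r - x t) /\<^sub>R (r - t))) \<longlongrightarrow> norm w) (at t within {0..T})"
    by (intro tendsto_norm has_vector_derivative_quotient x)
  have "norm ((x r - x t) /\<^sub>R (r - t)) \<le> L" if "r \<in> {0..T}" "r \<noteq> t" for r
  proof -
    have "norm (x r - x t) \<le> L * \<bar>r - t\<bar>"
      using lipschitz_onD[OF L that(1) t] by (simp add: dist_norm)
    then have "norm (x r - x t) / \<bar>r - t\<bar> \<le> L" using that(2) by (simp add: divide_le_eq)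
    then show ?thesis by (simp add: divide_inverse_commute abs_inverse)
  qed
  then show "\<forall>\<^sub>F r in at t within {0..T}. norm ((x r - x t) /\<^sub>R (r - t)) \<le> L"
    by (auto simp: eventually_at_filter)
  show "at t within {0..T} \<noteq> bot"
    using T t by (simp add: trivial_limit_within islimpt_Icc)
qed

text \<open>Moving back in time, \<open>x r\<close> is within \<open>O(t - r)\<close> of the polyhedron at time \<open>t\<close>, hence
  \<open>- (v \<bullet> w) \<le> \<kappa> * norm v\<close>; with \<open>w = g - v\<close> this is a quadratic inequality for \<open>norm v\<close>.\<close>

lemma sweeping_velocity_bound:
  fixes x :: "real \<Rightarrow> 'a::euclidean_space"
  assumes w: "(x has_vector_derivative w) (at t within {0..T})" and t: "0 < t" "t \<le> T"
    and v: "v \<in> normal_cone (x t) (poly_set s (\<lambda>j. a j t) (\<lambda>j. b j t))"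
    and wv: "w = - v + g" and g: "norm g \<le> G"
    and x: "\<And>r. r \<in> {0<..<t} \<Longrightarrow> x r \<in> poly_set s (\<lambda>j. a j r) (\<lambda>j. b j r)"
    and M: "\<And>r. r \<in> {0<..<t} \<Longrightarrow> norm (x r) \<le> M" and M0: "0 \<le> M"
    and a: "\<And>j r. j \<in> {1..s} \<Longrightarrow> r \<in> {0<..<t} \<Longrightarrow> norm (a j t - a j r) \<le> l * (t - r)"
    and b: "\<And>j r. j \<in> {1..s} \<Longrightarrow> r \<in> {0<..<t} \<Longrightarrow> \<bar>b j t - b j r\<bar> \<le> l * (t - r)"
    and l: "0 \<le> l" and z: "norm z \<le> R" "\<And>j. j \<in> {1..s} \<Longrightarrow> a j t \<bullet> z \<le> b j t - \<eta>" and \<eta>: "0 < \<eta>"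
  shows "norm w \<le> 2 * G + l * (1 + M) / \<eta> * (R + M)"
proof -
  define \<kappa> where "\<kappa> = l * (1 + M) / \<eta> * (R + M)"
  \<comment> \<open>Since \<open>r < t\<close>, division by \<open>r - t\<close> reverses the sign
    and gives a lower bound for \<open>v \<bullet> w\<close>. Quotients from the right would give
    only an upper bound, which says nothing about the size of \<open>v\<close> because
    \<open>v \<bullet> w\<close> contains minus its square.\<close>
  have quot: "- (norm v * \<kappa>) \<le> v \<bullet> ((x r - x t) /\<^sub>R (r - t))" if r: "r \<in> {0<..<t}" for r
  proof -
    have "v \<bullet> (x r - x t) \<le> norm v * ((l * (t - r)) * (1 + norm (x r)) / \<eta>) * norm (z - x r)"
      by (rule normal_cone_nearby_point[OF v x[OF r] a[OF _ r] b[OF _ r] z(2) \<eta>])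
        (use r l in auto)
    also have "\<dots> \<le> norm v * ((l * (t - r)) * (1 + M) / \<eta>) * (R + M)"
      using M[OF r] M0 z(1) l r \<eta> norm_triangle_ineq4[of z "x r"]
      by (intro mult_mono divide_right_mono mult_left_mono mult_nonneg_nonneg divide_nonneg_pos) auto
    also have "\<dots> = (t - r) * (norm v * \<kappa>)" by (simp add: \<kappa>_def)
    finally have "v \<bullet> (x r - x t) \<le> (t - r) * (norm v * \<kappa>)" .
    then have "- (norm v * \<kappa>) \<le> - ((v \<bullet> (x r - x t)) / (t - r))"
      using r by (simp add: field_simps)
    also have "\<dots> = (v \<bullet> (x r - x t)) / (r - t)"
      using r by (simp flip: divide_minus_right)
    also have "\<dots> = v \<bullet> ((x r - x t) /\<^sub>R (r - t))" by (simp add: divide_inverse_commute)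
    finally show ?thesis .
  qed
  have "- (norm v * \<kappa>) \<le> v \<bullet> w"
  proof (rule tendsto_lowerbound)
    have "((\<lambda>r. (x r - x t) /\<^sub>R (r - t)) \<longlongrightarrow> w) (at t within {0<..<t})"
      by (rule tendsto_within_subset[OF has_vector_derivative_quotient[OF w]]) (use t in auto)
    then show "((\<lambda>r. v \<bullet> ((x r - x t) /\<^sub>R (r - t))) \<longlongrightarrow> v \<bullet> w) (at t within {0<..<t})"
      by (intro tendsto_intros)
    show "\<forall>\<^sub>F r in at t within {0<..<t}. - (norm v * \<kappa>) \<le> v \<bullet> ((x r - x t) /\<^sub>R (r - t))"
      using quot by (auto simp: eventually_at_filter)
    show "at t within {0<..<t} \<noteq> bot"
      using t islimpt_greaterThanLessThan2[of 0 t] by (simp add: trivial_limit_within)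
  qed
  moreover have "v \<bullet> w = v \<bullet> g - norm v * norm v"
    by (simp add: wv inner_add_right inner_diff_right flip: power2_eq_square dot_square_norm)
  moreover have "v \<bullet> g \<le> norm v * G"
    using norm_cauchy_schwarz[of v g] mult_left_mono[OF g norm_ge_zero[of v]] by linarith
  ultimately have "norm v * norm v \<le> norm v * (G + \<kappa>)" by (simp add: algebra_simps)
  \<comment> \<open>Covers \<open>v = 0\<close>, where the factor \<open>norm v\<close> cannot be
    cancelled.\<close>
  moreover have "0 \<le> G + \<kappa>"
    using l M0 \<eta> norm_ge_zero[of g] norm_ge_zero[of z] g z(1)
    unfolding \<kappa>_def by (intro add_nonneg_nonneg mult_nonneg_nonneg divide_nonneg_pos) linarith+
  ultimately have "norm v \<le> G + \<kappa>"
    by (metis mult_left_le_imp_le norm_ge_zero order_le_less)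
  then show ?thesis
    using norm_triangle_ineq[of "- v" g] g by (simp add: wv \<kappa>_def)
qed

text \<open>The polygonal path from \<open>x0\<close> with slope \<open>w i\<close> on cell
  \<open>i\<close>. Written as an integral rather than by interpolation, it is compared with an
  absolutely continuous curve simply by comparing integrands.\<close>

definition step_primitive :: "real \<Rightarrow> nat \<Rightarrow> 'a::euclidean_space \<Rightarrow> (nat \<Rightarrow> 'a) \<Rightarrow> real \<Rightarrow> 'a" where
  "step_primitive T k x0 w t = x0 + integral {0..t} (\<lambda>r. w (cell T k r))"

context
  fixes T :: real and k :: nat and x0 :: "'a::euclidean_space" and w :: "nat \<Rightarrow> 'a"
  assumes T: "0 < T" and k: "1 \<le> k"
begin

lemma step_integrable_on: "0 \<le> p \<Longrightarrow> q \<le> T \<Longrightarrow> (\<lambda>r. w (cell T k r)) integrable_on {p..q}"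
  by (rule integrable_subinterval_real[OF has_integral_integrable[OF step_has_integral[OF T k]]]) auto

lemma step_primitive_0 [simp]: "step_primitive T k x0 w 0 = x0"
  by (simp add: step_primitive_def)

lemma step_primitive_increment:
  assumes "0 \<le> p" "p \<le> q" "q \<le> T"
  shows "step_primitive T k x0 w q - step_primitive T k x0 w p = integral {p..q} (\<lambda>r. w (cell T k r))"
  using Henstock_Kurzweil_Integration.integral_combine[OF assms(1,2) step_integrable_on[OF order_refl assms(3)]]
  by (simp add: step_primitive_def algebra_simps)

lemma grid_cell_subset: "i < k \<Longrightarrow> {grid T k i..grid T k (Suc i)} \<subseteq> {0..T}"
  using grid_mono[of T 0 i k] grid_mono[of T "Suc i" k k] grid_end[OF k, of T] T by auto

lemma step_primitive_cell:
  assumes i: "i < k" and t: "t \<in> {grid T k i..grid T k (Suc i)}"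
  shows "step_primitive T k x0 w t = step_primitive T k x0 w (grid T k i) + (t - grid T k i) *\<^sub>R w i"
proof -
  have "0 \<le> grid T k i" "t \<le> T" using grid_cell_subset[OF i] t by auto
  then have "step_primitive T k x0 w t - step_primitive T k x0 w (grid T k i)
      = integral {grid T k i..t} (\<lambda>r. w (cell T k r))"
    using t by (intro step_primitive_increment) auto
  also have "\<dots> = (t - grid T k i) *\<^sub>R w i"
    using t by (intro integral_unique step_has_integral_cell T i) auto
  finally show ?thesis by (simp add: algebra_simps)
qed

lemma piecewise_linear_step_primitive: "piecewise_linear T k (step_primitive T k x0 w)"
  unfolding piecewise_linear_def
proof (intro allI impI exI ballI)
  fix i t assume "i < k" "t \<in> {grid T k i..grid T k (Suc i)}"
  then show "step_primitive T k x0 w t =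
      (step_primitive T k x0 w (grid T k i) - grid T k i *\<^sub>R w i) + t *\<^sub>R w i"
    by (subst step_primitive_cell) (auto simp: algebra_simps)
qed

lemma step_primitive_derivative_cell:
  assumes i: "i < k" and t: "t \<in> {grid T k i..grid T k (Suc i)}"
  shows "(step_primitive T k x0 w has_vector_derivative w i)
    (at t within {grid T k i..grid T k (Suc i)})"
proof (rule has_vector_derivative_transform[OF t step_primitive_cell[OF i]])
  show "((\<lambda>t. step_primitive T k x0 w (grid T k i) + (t - grid T k i) *\<^sub>R w i)
      has_vector_derivative w i) (at t within {grid T k i..grid T k (Suc i)})"
    by (auto intro!: derivative_eq_intros)
qed

text \<open>Grid points are kinks: there the slope of the new cell is seen only from the right, in
  accordance with half-open cells.\<close>

lemma step_primitive_derivative_right: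
  assumes i: "i < k" and t: "t \<in> {grid T k i..<grid T k (Suc i)}"
  shows "(step_primitive T k x0 w has_vector_derivative w i) (at_right t)"
proof -
  have "(step_primitive T k x0 w has_vector_derivative w i) (at t within {t<..<grid T k (Suc i)})"
    using step_primitive_derivative_cell[OF i, of t] t
    by (auto intro: has_vector_derivative_within_subset)
  moreover have "at t within {t<..<grid T k (Suc i)} = at_right t"
    using t by (intro at_within_nhd[of _ "{..<grid T k (Suc i)}"]) auto
  ultimately show ?thesis by simp
qed

lemma step_primitive_velocity:
  assumes t: "t \<in> {0..T} - grid T k ` {..k}"
  shows "(step_primitive T k x0 w has_vector_derivative w (cell T k t)) (at t within {0..T})"
    and "velocity T (step_primitive T k x0 w) t = w (cell T k t)"
proof -
  define i where "i = cell T k t"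
  have i: "i < k" using cell_less[OF k] by (simp add: i_def)
  have "t \<in> {grid T k i..grid T k (Suc i)}" using cell_bounds[OF T k] t by (simp add: i_def)
  moreover have "t \<noteq> grid T k i" "t \<noteq> grid T k (Suc i)"
    using t i by (auto simp del: grid_0)
  ultimately have ti: "t \<in> {grid T k i<..<grid T k (Suc i)}" by auto
  have "(step_primitive T k x0 w has_vector_derivative w i) (at t within {grid T k i<..<grid T k (Suc i)})"
    by (rule has_vector_derivative_within_subset[OF step_primitive_derivative_cell[OF i]]) (use ti in auto)
  then have "(step_primitive T k x0 w has_vector_derivative w i) (at t)"
    using ti by (simp add: at_within_open[of t "{grid T k i<..<grid T k (Suc i)}"])
  then show *: "(step_primitive T k x0 w has_vector_derivative w (cell T k t)) (at t within {0..T})"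
    unfolding i_def by (rule has_vector_derivative_at_within)
  show "velocity T (step_primitive T k x0 w) t = w (cell T k t)"
    unfolding velocity_def using vector_derivative_within_closed_interval[OF T _ *] t by auto
qed

lemma negligible_grid: "negligible (grid T k ` {..k})"
  by (intro negligible_finite) simp

lemma step_absolutely_integrable: "(\<lambda>r. w (cell T k r)) absolutely_integrable_on {0..T}"
proof (rule bounded_measurable_L2(2)[OF step_measurable_lebesgue_on negligible_empty])
  show "norm (w (cell T k t)) \<le> (\<Sum>i<k. norm (w i))" if "t \<in> {0..T} - {}" for t
    using cell_less[OF k, of T t] by (intro member_le_sum) auto
qed

lemma velocity_step_primitive_absolutely_integrable:
  "velocity T (step_primitive T k x0 w) absolutely_integrable_on {0..T}"
  by (rule absolutely_integrable_spike[OF step_absolutely_integrable negligible_grid])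
    (simp add: step_primitive_velocity(2))

lemma W12_on_step_primitive: "W12_on T (step_primitive T k x0 w)"
proof -
  note vi = velocity_step_primitive_absolutely_integrable
  have "AE t in lebesgue. t \<in> {0..T} \<longrightarrow> step_primitive T k x0 w differentiable (at t within {0..T})"
    by (rule AE_lebesgue_on_interval[OF negligible_grid])
      (use step_primitive_velocity(1) in \<open>blast intro: differentiableI_vector\<close>)
  moreover have "step_primitive T k x0 w t = step_primitive T k x0 w 0 +
      (LINT r:{0..t}|lebesgue. velocity T (step_primitive T k x0 w) r)" if t: "t \<in> {0..T}" for t
  proof -
    have "set_integrable lebesgue {0..t} (velocity T (step_primitive T k x0 w))"
      by (rule set_integrable_subset[OF vi]) (use t in auto)
    then have "(LINT r:{0..t}|lebesgue. velocity T (step_primitive T k x0 w) r)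
        = integral {0..t} (velocity T (step_primitive T k x0 w))"
      by (rule set_lebesgue_integral_eq_integral(2))
    also have "\<dots> = integral {0..t} (\<lambda>r. w (cell T k r))"
      by (rule integral_spike[OF negligible_grid]) (use t step_primitive_velocity(2) in auto)
    finally show ?thesis by (simp add: step_primitive_def)
  qed
  ultimately have "abs_cont_on T (step_primitive T k x0 w)"
    unfolding abs_cont_on_def using vi by blast
  moreover have "L2_on T (velocity T (step_primitive T k x0 w))"
  proof (rule bounded_measurable_L2(1)[OF _ negligible_grid])
    show "velocity T (step_primitive T k x0 w) \<in> borel_measurable (lebesgue_on {0..T})"
      using vi by (simp add: absolutely_integrable_imp_borel_measurable)
    show "norm (velocity T (step_primitive T k x0 w) t) \<le> (\<Sum>i<k. norm (w i))"
      if "t \<in> {0..T} - grid T k ` {..k}" for t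
      unfolding step_primitive_velocity(2)[OF that]
      using cell_less[OF k, of T t] by (intro member_le_sum) auto
  qed
  ultimately show ?thesis by (simp add: W12_on_def)
qed

lemma step_primitive_lipschitz:
  assumes "0 \<le> L" "\<And>i. i < k \<Longrightarrow> norm (w i) \<le> L"
  shows "L-lipschitz_on {0..T} (step_primitive T k x0 w)"
proof (rule abs_cont_on_lipschitz[OF _ negligible_grid assms(1)])
  show "abs_cont_on T (step_primitive T k x0 w)"
    using W12_on_step_primitive by (simp add: W12_on_def)
  show "norm (velocity T (step_primitive T k x0 w) t) \<le> L" if "t \<in> {0..T} - grid T k ` {..k}" for t
    unfolding step_primitive_velocity(2)[OF that] using assms(2) cell_less[OF k] by blast
qed

end

text \<open>Both curves start at \<open>x 0\<close>, so at any time they differ by an integral of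
  the velocity gap.\<close>

lemma step_primitive_uniform_distance:
  fixes x :: "real \<Rightarrow> 'a::euclidean_space"
  assumes T: "0 < T" and k: "1 \<le> k" and x: "abs_cont_on T x" and t: "t \<in> {0..T}"
  shows "norm (step_primitive T k (x 0) w t - x t)
    \<le> integral {0..T} (\<lambda>r. norm (w (cell T k r) - velocity T x r))"
proof -
  have vx: "set_integrable lebesgue {0..T} (velocity T x)"
    using x unfolding abs_cont_on_def by blast
  have ai: "(\<lambda>r. w (cell T k r) - velocity T x r) absolutely_integrable_on {0..T}"
    by (rule set_integral_diff(1)[OF step_absolutely_integrable[OF T k] vx])
  have ai': "(\<lambda>r. w (cell T k r) - velocity T x r) absolutely_integrable_on {0..t}"
    by (rule set_integrable_subset[OF ai]) (use t in auto)
  have "step_primitive T k (x 0) w t - x t = integral {0..t} (\<lambda>r. w (cell T k r)) - integral {0..t} (velocity T x)"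
    using abs_cont_on_increment(1)[OF x, of 0 t] t by (simp add: step_primitive_def algebra_simps)
  also have "\<dots> = integral {0..t} (\<lambda>r. w (cell T k r) - velocity T x r)"
    using abs_cont_on_increment(2)[OF x, of 0 t] step_integrable_on[OF T k, of 0 t w] t
    by (intro integral_diff[symmetric]) auto
  also have "norm \<dots> \<le> integral {0..t} (\<lambda>r. norm (w (cell T k r) - velocity T x r))"
    using ai' by (intro Henstock_Kurzweil_Integration.integral_norm_bound_integral)
      (auto simp: absolutely_integrable_on_def)
  also have "\<dots> \<le> integral {0..T} (\<lambda>r. norm (w (cell T k r) - velocity T x r))"
    using ai ai' t by (intro integral_subset_le) (auto simp: absolutely_integrable_on_def)
  finally show ?thesis .
qed

lemma step_primitive_W12_distance:
  fixes x :: "real \<Rightarrow> 'a::euclidean_space"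
  assumes T: "0 < T" and k: "1 \<le> k" and x: "abs_cont_on T x" and N: "negligible N"
    and diff: "\<And>t. t \<in> {0..T} - N \<Longrightarrow> x differentiable (at t within {0..T})"
    and B: "\<And>t. t \<in> {0..T} - N \<Longrightarrow> norm (velocity T x t) \<le> B" "\<And>i. i < k \<Longrightarrow> norm (w i) \<le> B"
  shows "W12_norm T (\<lambda>t. step_primitive T k (x 0) w t - x t)
    \<le> sqrt (2 * B * integral {0..T} (\<lambda>r. norm (w (cell T k r) - velocity T x r)))"
proof -
  define y where "y t = step_primitive T k (x 0) w t - x t" for t
  \<comment> \<open>Off this set both curves are differentiable: \<open>N\<close> serves
    \<open>x\<close>, the grid points serve the polygonal path.\<close>
  define N' where "N' = N \<union> grid T k ` {..k}"
  have N': "negligible N'" using N negligible_grid[OF T k] by (simp add: N'_def negligible_Un)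
  have vy: "velocity T y t = w (cell T k t) - velocity T x t" if t: "t \<in> {0..T} - N'" for t
  proof -
    have "(x has_vector_derivative velocity T x t) (at t within {0..T})"
      using diff[of t] t by (simp add: velocity_def N'_def vector_derivative_works)
    moreover have "(step_primitive T k (x 0) w has_vector_derivative w (cell T k t)) (at t within {0..T})"
      using t by (intro step_primitive_velocity(1) T k) (simp add: N'_def)
    ultimately have "(y has_vector_derivative w (cell T k t) - velocity T x t) (at t within {0..T})"
      unfolding y_def by (intro has_vector_derivative_diff)
    then show ?thesis
      unfolding velocity_def using t by (intro vector_derivative_within_closed_interval T) auto
  qed
  have vx: "set_integrable lebesgue {0..T} (velocity T x)"
    using x unfolding abs_cont_on_def by blast
  have "velocity T y absolutely_integrable_on {0..T}"
    by (rule absolutely_integrable_spike[OF set_integral_diff(1)[OF step_absolutely_integrable[OF T k, of w] vx] N'])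
      (simp add: vy)
  then have m: "velocity T y \<in> borel_measurable (lebesgue_on {0..T})"
    by (simp add: absolutely_integrable_imp_borel_measurable)
  \<comment> \<open>Both velocities are bounded by \<open>B\<close>, which gives the factor
    \<open>2 * B\<close> when passing from \<open>L1\<close> to \<open>L2\<close>.\<close>
  have "norm (velocity T y t) \<le> 2 * B" if "t \<in> {0..T} - N'" for t
    using B(1)[of t] B(2)[OF cell_less[OF k, of T t]] that
      norm_triangle_ineq4[of "w (cell T k t)" "velocity T x t"]
    by (auto simp: vy N'_def)
  from bounded_measurable_L2(3)[OF m N' this]
  have "L2_norm T (velocity T y) \<le> sqrt (2 * B * integral {0..T} (\<lambda>t. norm (velocity T y t)))" .
  also have "integral {0..T} (\<lambda>t. norm (velocity T y t))
      = integral {0..T} (\<lambda>r. norm (w (cell T k r) - velocity T x r))"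
    by (rule integral_spike[OF N']) (simp add: vy)
  finally show ?thesis
    using T k by (simp add: W12_norm_def y_def[abs_def])
qed

section \<open>Lipschitz continuity of sweeping trajectories\<close>

lemma sweeping_solution_lipschitz:
  fixes x :: "real \<Rightarrow> 'a::euclidean_space" and u :: "real \<Rightarrow> 'b::euclidean_space"
  assumes T: "0 < T" and x: "abs_cont_on T x"
    and incl: "AE t in lebesgue. t \<in> {0..T} \<longrightarrow> velocity T x t \<in>
        {- v + g (x t) (u t) | v. v \<in> normal_cone (x t) (poly_set s (\<lambda>j. a j t) (\<lambda>j. b j t))}"
    and u: "AE t in lebesgue. t \<in> {0..T} \<longrightarrow> u t \<in> U"
    and growth: "\<And>y u. u \<in> U \<Longrightarrow> norm (g y u) \<le> \<beta> * (1 + norm y)" and \<beta>: "0 < \<beta>"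
    and a: "\<And>j p q. j \<in> {1..s} \<Longrightarrow> p \<in> {0..T} \<Longrightarrow> q \<in> {0..T} \<Longrightarrow> norm (a j p - a j q) \<le> l * \<bar>p - q\<bar>"
    and b: "\<And>j p q. j \<in> {1..s} \<Longrightarrow> p \<in> {0..T} \<Longrightarrow> q \<in> {0..T} \<Longrightarrow> \<bar>b j p - b j q\<bar> \<le> l * \<bar>p - q\<bar>"
    and l: "0 \<le> l"
    and slater: "\<And>t. t \<in> {0..T} \<Longrightarrow> \<exists>z. norm z \<le> R \<and> (\<forall>j\<in>{1..s}. a j t \<bullet> z \<le> b j t - \<eta>)"
    and \<eta>: "0 < \<eta>"
  shows "\<exists>K. K-lipschitz_on {0..T} x"
proof -
  have cont: "continuous_on {0..T} x" by (rule abs_cont_on_imp_continuous_on[OF x])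
  then have "bounded (x ` {0..T})"
    by (intro compact_imp_bounded compact_continuous_image) auto
  then obtain M where M: "0 < M" "\<And>t. t \<in> {0..T} \<Longrightarrow> norm (x t) \<le> M"
    by (auto simp: bounded_pos)
  have ca: "continuous_on {0..T} (a j)" and cb: "continuous_on {0..T} (b j)" if "j \<in> {1..s}" for j
    using a[OF that] b[OF that] l
    by (auto intro!: lipschitz_on_continuous_on[of l] lipschitz_onI simp: dist_norm)
  \<comment> \<open>The inclusion gives membership only almost everywhere, whereas the backward
    quotients use all earlier times. For each constraint the good times form a closed set of full
    measure, which therefore contains the whole open interval.\<close>
  have mem: "x t \<in> poly_set s (\<lambda>j. a j t) (\<lambda>j. b j t)" if t: "t \<in> {0<..<T}" for t
    unfolding mem_poly_set
  proof
    fix j assume j: "j \<in> {1..s}"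
    define S where "S = {r \<in> {0..T}. a j r \<bullet> x r \<le> b j r}"
    have "S = {0..T} \<inter> (\<lambda>r. a j r \<bullet> x r - b j r) -` {..0}" by (auto simp: S_def)
    also have "closed \<dots>"
      using cont ca[OF j] cb[OF j] by (intro continuous_closed_preimage continuous_intros) auto
    finally have S: "closed S" .
    have "AE r\<in>{0<..<T} in lebesgue. r \<in> S"
      using incl
    proof eventually_elim
      case (elim r)
      then show ?case
        using j by (auto simp: S_def mem_poly_set dest!: normal_coneD)
    qed
    from mem_closed_if_AE_lebesgue_open[OF open_greaterThanLessThan S this t]
    show "a j t \<bullet> x t \<le> b j t" by (simp add: S_def)
  qed
  define K where "K = 2 * (\<beta> * (1 + M)) + l * (1 + M) / \<eta> * (R + M)"
  have "AE t in lebesgue. t \<in> {0..T} \<longrightarrow> x differentiable (at t within {0..T})"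
    using x unfolding abs_cont_on_def by blast
  \<comment> \<open>Time \<open>0\<close> has no past to compare with; it is added to the null set
    at the end.\<close>
  then have "AE t in lebesgue. t \<in> {0<..T} \<longrightarrow> norm (velocity T x t) \<le> K"
    using incl u
  proof eventually_elim
    case (elim t)
    show ?case
    proof
      assume t: "t \<in> {0<..T}"
      obtain v where v: "v \<in> normal_cone (x t) (poly_set s (\<lambda>j. a j t) (\<lambda>j. b j t))"
        "velocity T x t = - v + g (x t) (u t)" using elim t by auto
      have w: "(x has_vector_derivative velocity T x t) (at t within {0..T})"
        using elim t by (simp add: velocity_def vector_derivative_works)
      have "norm (g (x t) (u t)) \<le> \<beta> * (1 + norm (x t))" using growth elim t by auto
      also have "\<dots> \<le> \<beta> * (1 + M)" using M(2)[of t] t \<beta> by (intro mult_left_mono) auto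
      finally have G: "norm (g (x t) (u t)) \<le> \<beta> * (1 + M)" .
      obtain z where z: "norm z \<le> R" "\<And>j. j \<in> {1..s} \<Longrightarrow> a j t \<bullet> z \<le> b j t - \<eta>"
        using slater[of t] t by auto
      show "norm (velocity T x t) \<le> K"
        unfolding K_def
      proof (rule sweeping_velocity_bound[where x = x and a = a and b = b and t = t, OF w _ _ v G _ _ _ _ _ l z \<eta>])
        show "norm (a j t - a j r) \<le> l * (t - r)" if "j \<in> {1..s}" "r \<in> {0<..<t}" for j r
          using a[OF that(1), of t r] that(2) t by auto
        show "\<bar>b j t - b j r\<bar> \<le> l * (t - r)" if "j \<in> {1..s}" "r \<in> {0<..<t}" for j r
          using b[OF that(1), of t r] that(2) t by auto
      qed (use t M mem in auto)
    qed
  qed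
  then obtain N where N: "negligible N" "\<And>t. t \<notin> N \<Longrightarrow> t \<in> {0<..T} \<Longrightarrow> norm (velocity T x t) \<le> K"
    unfolding eventually_ae_filter_negligible by blast
  have "K \<le> max 0 K" by simp
  then have "(max 0 K)-lipschitz_on {0..T} x"
    using N by (intro abs_cont_on_lipschitz[OF x, of "insert 0 N"]) force+
  then show ?thesis by blast
qed

section \<open>Uniform convergence of piecewise linear extensions\<close>

lemma pl_ext_dist_le:
  fixes v :: "nat \<Rightarrow> 'a::real_normed_vector"
  assumes T: "0 < T" "1 \<le> k" "0 \<le> t" and i: "i = nat \<lfloor>t / (T / real k)\<rfloor>"
    and v: "norm (v i - y) \<le> d" "norm (v (Suc i) - y) \<le> d"
  shows "norm (pl_ext T k v t - y) \<le> d"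
proof -
  define \<theta> where "\<theta> = t / (T / real k) - real i"
  have "0 \<le> t / (T / real k)" using T by simp
  then have \<theta>: "0 \<le> \<theta>" "\<theta> \<le> 1" unfolding \<theta>_def i by linarith+
  \<comment> \<open>The extension is a convex combination of two neighbouring values, and balls are
    convex.\<close>
  have "pl_ext T k v t - y = (1 - \<theta>) *\<^sub>R (v i - y) + \<theta> *\<^sub>R (v (Suc i) - y)"
    by (simp add: pl_ext_def Let_def \<theta>_def i algebra_simps)
  also have "norm \<dots> \<le> (1 - \<theta>) * d + \<theta> * d"
    using \<theta> v by (intro norm_triangle_le add_mono) (auto intro: mult_left_mono)
  finally show ?thesis by (simp add: algebra_simps)
qed

text \<open>The bound \<open>k + 1\<close> on the index comes from \<open>t = T\<close>: there
  \<open>pl_ext\<close> starts at index \<open>k\<close> and refers to \<open>V k (k + 1)\<close>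
  with weight zero. The convexity estimate still asks that value to be close to
  \<open>f t\<close>.\<close>

lemma pl_ext_uniform_limit:
  fixes V :: "nat \<Rightarrow> nat \<Rightarrow> 'a::real_normed_vector"
  assumes T: "0 < T" and d: "d \<longlonglongrightarrow> 0"
    and V: "\<And>k t m. 1 \<le> k \<Longrightarrow> t \<in> {0..T} \<Longrightarrow> m \<le> k + 1 \<Longrightarrow> \<bar>t - grid T k m\<bar> \<le> T / real k \<Longrightarrow>
      norm (V k m - f t) \<le> d k"
  shows "uniform_limit {0..T} (\<lambda>k. pl_ext T k (V k)) f sequentially"
proof (rule uniform_limitI)
  fix e :: real assume "0 < e"
  with d have "\<forall>\<^sub>F k in sequentially. d k < e" by (rule order_tendstoD(2))
  with eventually_ge_at_top[of 1]
  show "\<forall>\<^sub>F k in sequentially. \<forall>t\<in>{0..T}. dist (pl_ext T k (V k) t) (f t) < e"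
  proof eventually_elim
    case (elim k)
    show ?case
    proof
      fix t assume t: "t \<in> {0..T}"
      define r i where "r = t / (T / real k)" and "i = nat \<lfloor>r\<rfloor>"
      have r: "0 \<le> r" "r \<le> real k" using t T elim(1) by (auto simp: r_def field_simps)
      have tr: "t = r * (T / real k)" using T elim(1) by (simp add: r_def)
      have i: "real i \<le> r" "r \<le> real i + 1" "i \<le> k" using r unfolding i_def by linarith+
      have "norm (V k m - f t) \<le> d k" if "m = i \<or> m = Suc i" for m
      proof (rule V[OF elim(1) t])
        show "m \<le> k + 1" using that i by auto
        have "t - grid T k m = (r - real m) * (T / real k)" by (simp add: tr grid_def left_diff_distrib diff_divide_distrib)
        moreover have "\<bar>r - real m\<bar> \<le> 1" using that i by auto
        ultimately show "\<bar>t - grid T k m\<bar> \<le> T / real k"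
          using T mult_right_mono[of "\<bar>r - real m\<bar>" 1 "T / real k"] by (simp add: abs_mult)
      qed
      then have "norm (pl_ext T k (V k) t - f t) \<le> d k"
        using t by (intro pl_ext_dist_le[OF T elim(1)]) (auto simp: i_def r_def)
      then show "dist (pl_ext T k (V k) t) (f t) < e" using elim(2) by (simp add: dist_norm)
    qed
  qed
qed

text \<open>The duration \<open>0\<close> is admissible: then \<open>at t within {0..0}\<close> is the trivial filter, \<open>velocity\<close> is
  an arbitrary function, and only the nullity of \<open>{0}\<close> matters.\<close>

lemma L2_degenerate:
  fixes f :: "real \<Rightarrow> 'a::euclidean_space"
  shows "L2_on 0 f" "L2_norm 0 f = 0" "f absolutely_integrable_on {0..0}"
proof -
  have N: "negligible {0::real}" by simp
  have zero: "(\<lambda>t. 0::'a) absolutely_integrable_on {0..0::real}" by simp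
  show ai: "f absolutely_integrable_on {0..0}"
    by (rule absolutely_integrable_spike[OF zero N]) auto
  then have m: "f \<in> borel_measurable (lebesgue_on {0..0})"
    by (intro absolutely_integrable_imp_borel_measurable) auto
  have B: "norm (f t) \<le> 0" if "t \<in> {0..0} - {0}" for t using that by auto
  show "L2_on 0 f" by (rule bounded_measurable_L2(1)[OF m N B])
  have "L2_norm 0 f \<le> 0" using bounded_measurable_L2(3)[OF m N B] by simp
  moreover have "0 \<le> L2_norm 0 f"
    unfolding L2_norm_def set_lebesgue_integral_def by simp
  ultimately show "L2_norm 0 f = 0" by simp
qed

lemma W12_on_degenerate:
  fixes x :: "real \<Rightarrow> 'a::euclidean_space"
  shows "W12_on 0 x"
proof -
  have "AE t in lebesgue. t \<in> {0..0} \<longrightarrow> x differentiable (at t within {0..0})"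
    by (rule AE_lebesgue_on_interval[of "{0}"]) auto
  moreover have "x t = x 0 + (LINT r:{0..t}|lebesgue. velocity 0 x r)" if "t \<in> {0..0}" for t
    using that set_lebesgue_integral_eq_integral(2)[OF L2_degenerate(3)[of "velocity 0 x"]] by simp
  ultimately show ?thesis
    unfolding W12_on_def abs_cont_on_def using L2_degenerate(1,3) by blast
qed

lemma velocity_lipschitz_bound:
  fixes x :: "real \<Rightarrow> 'a::euclidean_space"
  assumes "L-lipschitz_on {0..T} x" "0 < T" "t \<in> {0..T}" "x differentiable (at t within {0..T})"
  shows "norm (velocity T x t) \<le> L"
  using assms lipschitz_on_derivative_bound[of L T x t "velocity T x t"]
  by (simp add: velocity_def vector_derivative_works)

text \<open>Sampling the pair in the product space yields common points for both functions; the
  coordinate projections do not increase distances, so one error bounds both.\<close>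

lemma simultaneous_step_sampling:
  fixes f :: "real \<Rightarrow> 'a::euclidean_space" and u :: "real \<Rightarrow> 'b::euclidean_space"
  assumes T: "0 < T" and f: "f \<in> borel_measurable (lebesgue_on {0..T})"
    and u: "u \<in> borel_measurable (lebesgue_on {0..T})" and N: "negligible N"
    and B: "\<And>t. t \<in> {0..T} - N \<Longrightarrow> norm (f t) \<le> A" "\<And>t. t \<in> {0..T} - N \<Longrightarrow> norm (u t) \<le> B"
  obtains S e where
    "\<And>k i. k \<ge> 1 \<Longrightarrow> i < k \<Longrightarrow> S k i \<in> {grid T k i..<grid T k (Suc i)} - N"
    "\<And>k. k \<ge> 1 \<Longrightarrow> integral {0..T} (\<lambda>t. norm (f (S k (cell T k t)) - f t)) \<le> e k"
    "\<And>k. k \<ge> 1 \<Longrightarrow> integral {0..T} (\<lambda>t. norm (u (S k (cell T k t)) - u t)) \<le> e k"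
    "e \<longlonglongrightarrow> 0"
proof -
  \<comment> \<open>The bounds hold only off \<open>N\<close>, while \<open>step_sampling\<close>
    wants one everywhere. Redefinition on \<open>N\<close> is harmless because the sampling points
    avoid it.\<close>
  define F where "F t = (if t \<in> N then 0 else (f t, u t))" for t
  define C where "C = \<bar>A\<bar> + \<bar>B\<bar>"
  have "0 \<le> C" by (simp add: C_def)
  have FC: "norm (F t) \<le> C" if "t \<in> {0..T}" for t
    using B[of t] that norm_Pair_le[of "f t" "u t"] by (auto simp: F_def C_def)
  have Nm: "N \<in> sets lebesgue" using N by (rule negligible_imp_sets)
  have "{t \<in> space (lebesgue_on {0..T}). t \<in> N} \<in> sets (lebesgue_on {0..T})"
    using Nm by (auto simp: sets_restrict_space space_restrict_space)
  then have Fm: "F \<in> borel_measurable (lebesgue_on {0..T})"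
    unfolding F_def using f u by (intro measurable_If borel_measurable_Pair) auto
  obtain S where S: "\<And>k i. k \<ge> 1 \<Longrightarrow> i < k \<Longrightarrow> S k i \<in> {grid T k i..<grid T k (Suc i)} - N"
    and lim: "(\<lambda>k. integral {0..T} (\<lambda>t. norm (F t - F (S k (cell T k t))))) \<longlonglongrightarrow> 0"
    using step_sampling[OF T Fm \<open>0 \<le> C\<close> FC N] by blast
  define e where "e k = integral {0..T} (\<lambda>t. norm (F t - F (S k (cell T k t))))" for k
  have S01: "S k (cell T k t) \<in> {0..T} - N" if "k \<ge> 1" for k t
    using S[OF that cell_less[OF that]] grid_cell_subset[OF T that cell_less[OF that]] by fastforce
  \<comment> \<open>\<open>\<pi>\<close> stands for either coordinate projection and
    \<open>h\<close> for the corresponding component, equal to it off \<open>N\<close>.\<close>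
  have comp: "integral {0..T} (\<lambda>t. norm (h (S k (cell T k t)) - h t)) \<le> e k"
    if k: "k \<ge> 1" and \<pi>: "\<And>p q. norm (\<pi> p - \<pi> q) \<le> norm (p - q)" "\<pi> \<in> borel_measurable borel"
      and h: "\<And>t. t \<in> {0..T} - N \<Longrightarrow> h t = \<pi> (F t)"
    for k and \<pi> :: "'a \<times> 'b \<Rightarrow> 'c::euclidean_space" and h
  proof -
    have Fs: "(\<lambda>t. F (S k (cell T k t))) \<in> borel_measurable (lebesgue_on {0..T})"
      by (rule step_measurable_lebesgue_on)
    have bound: "norm (F t - F (S k (cell T k t))) \<le> 2 * C" if "t \<in> {0..T}" for t
      using FC[OF that] FC[of "S k (cell T k t)"] S01[OF k, of t]
        norm_triangle_ineq4[of "F t" "F (S k (cell T k t))"] by auto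
    have int: "(\<lambda>t. norm (F t - F (S k (cell T k t)))) integrable_on {0..T}"
    proof (rule measurable_bounded_by_integrable_imp_integrable)
      show "(\<lambda>t. norm (F t - F (S k (cell T k t)))) \<in> borel_measurable (lebesgue_on {0..T})"
        by (rule measurable_compose[OF borel_measurable_diff[OF Fm Fs] borel_measurable_norm])
      show "norm (norm (F t - F (S k (cell T k t)))) \<le> 2 * C" if "t \<in> {0..T}" for t
        using bound[OF that] by simp
    qed auto
    have "integral {0..T} (\<lambda>t. norm (h (S k (cell T k t)) - h t))
        = integral {0..T} (\<lambda>t. norm (\<pi> (F t) - \<pi> (F (S k (cell T k t)))))"
      using h S01[OF k] by (intro integral_spike[OF N]) (simp add: norm_minus_commute)
    also have "\<dots> \<le> e k"
      unfolding e_def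
    proof (rule integral_le[OF _ int])
      show "(\<lambda>t. norm (\<pi> (F t) - \<pi> (F (S k (cell T k t))))) integrable_on {0..T}"
      proof (rule measurable_bounded_by_integrable_imp_integrable)
        show "(\<lambda>t. norm (\<pi> (F t) - \<pi> (F (S k (cell T k t))))) \<in> borel_measurable (lebesgue_on {0..T})"
          by (rule measurable_compose[OF borel_measurable_diff[OF measurable_compose[OF Fm \<pi>(2)]
              measurable_compose[OF Fs \<pi>(2)]] borel_measurable_norm])
        show "norm (norm (\<pi> (F t) - \<pi> (F (S k (cell T k t))))) \<le> 2 * C" if "t \<in> {0..T}" for t
          using order_trans[OF \<pi>(1) bound[OF that]] by simp
      qed auto
    qed (rule \<pi>(1))
    finally show ?thesis .
  qed
  show ?thesis
  proof (rule that[of S e])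
    show "integral {0..T} (\<lambda>t. norm (f (S k (cell T k t)) - f t)) \<le> e k" if "k \<ge> 1" for k
    proof (rule comp[OF that, of fst])
      show "norm (fst p - fst q) \<le> norm (p - q)" for p q :: "'a \<times> 'b"
        using dist_fst_le[of p q] by (simp add: dist_norm)
    qed (auto simp: F_def borel_measurable_continuous_onI continuous_on_fst)
    show "integral {0..T} (\<lambda>t. norm (u (S k (cell T k t)) - u t)) \<le> e k" if "k \<ge> 1" for k
    proof (rule comp[OF that, of snd])
      show "norm (snd p - snd q) \<le> norm (p - q)" for p q :: "'a \<times> 'b"
        using dist_snd_le[of p q] by (simp add: dist_norm)
    qed (auto simp: F_def borel_measurable_continuous_onI continuous_on_snd)
    show "e \<longlonglongrightarrow> 0" using lim by (simp add: e_def[abs_def])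
  qed (rule S)
qed

subsection \<open>Discrete approximation\<close>

theorem theorem2p1:
  fixes s :: nat
    and xs :: "nat \<Rightarrow> real \<Rightarrow> real ^ 'n"
    and c :: "nat \<Rightarrow> real \<Rightarrow> real"
    and C :: "real \<Rightarrow> (real ^ 'n) set"
    and g :: "real ^ 'n \<Rightarrow> real ^ 'd \<Rightarrow> real ^ 'n"
    and U :: "(real ^ 'd) set"
    and x0 :: "real ^ 'n"
    and \<Omega>x :: "(real ^ 'n) set"
    and \<Omega>T :: "real set"
    and xbar :: "real \<Rightarrow> real ^ 'n"
    and ubar :: "real \<Rightarrow> real ^ 'd"
    and Tbar :: real
  defines "C \<equiv> (\<lambda>t. poly_set s (\<lambda>j. xs j t) (\<lambda>j. c j t))"
  assumes unit: "\<forall>j\<in>{1..s}. \<forall>t\<ge>0. norm (xs j t) = 1"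
    and \<Omega>T: "\<Omega>T \<subseteq> {0..}"
    and H1_U: "U \<noteq> {}" "closed U" "bounded U"
    and H1_lip: "\<exists>L. \<forall>j\<in>{1..s}. L-lipschitz_on {0..} (xs j) \<and> L-lipschitz_on {0..} (c j)"
    and H2: "\<forall>t\<in>{0..Tbar}. \<exists>x. \<forall>j\<in>{1..s}. xs j t \<bullet> x < c j t"
    and H3_lip: "\<forall>B. bounded B \<longrightarrow> (\<exists>L. L-lipschitz_on (B \<times> U) (\<lambda>(x, u). g x u))"
    and H3_growth: "\<exists>\<beta>>0. \<forall>x. \<forall>u\<in>U. norm (g x u) \<le> \<beta> * (1 + norm x)"
    and feas: "feasible C g U x0 \<Omega>x \<Omega>T xbar ubar Tbar"
    and W12: "W12_on Tbar xbar"
    and L2: "L2_on Tbar ubar"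
  shows "\<exists>(u :: nat \<Rightarrow> real \<Rightarrow> real ^ 'd) (x :: nat \<Rightarrow> real \<Rightarrow> real ^ 'n)
           (\<tau> :: nat \<Rightarrow> nat \<Rightarrow> real) (ck :: nat \<Rightarrow> nat \<Rightarrow> nat \<Rightarrow> real).
      \<comment> \<open>(i)\<close>
      (\<forall>k\<ge>1. piecewise_constant Tbar k (u k) \<and> (\<forall>t\<in>{0..Tbar}. u k t \<in> U)) \<and>
      L2_converges Tbar u ubar \<and>
      \<comment> \<open>(ii)\<close>
      (\<forall>k\<ge>1. piecewise_linear Tbar k (x k)) \<and>
      W12_converges Tbar x xbar \<and>
      (\<forall>k\<ge>1. x k 0 = xbar 0) \<and>
      (\<forall>k\<ge>1. \<forall>i<k. \<forall>t\<in>{grid Tbar k i..<grid Tbar k (Suc i)}.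
         \<exists>w. (x k has_vector_derivative w) (at_right t) \<and>
           w \<in> {- v + g (x k (grid Tbar k i)) (u k (grid Tbar k i)) + \<tau> k i *\<^sub>R b | v b.
                 v \<in> normal_cone (x k (grid Tbar k i))
                       (poly_set s (\<lambda>j. xs j (grid Tbar k i)) (\<lambda>j. ck k i j)) \<and>
                 b \<in> cball 0 1}) \<and>
      (\<forall>k\<ge>1. \<forall>i<k. 0 \<le> \<tau> k i) \<and>
      (\<lambda>k. (Tbar / real k) * (\<Sum>i\<in>{1..k - 1}. \<tau> k i)) \<longlonglongrightarrow> 0 \<and>
      \<comment> \<open>(iii)\<close>
      (\<forall>j\<in>{1..s}.
         uniform_limit {0..Tbar} (\<lambda>k. pl_ext' Tbar k (\<lambda>i. ck k i j)) (c j) sequentially \<and>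
         uniform_limit {0..Tbar} (\<lambda>k. pl_ext Tbar k (\<lambda>i. xs j (grid Tbar k i))) (xs j)
           sequentially) \<and>
      (\<exists>L. L-lipschitz_on {0..Tbar} xbar) \<and>
      (\<forall>L. L-lipschitz_on {0..Tbar} xbar \<longrightarrow> (\<forall>k\<ge>1. L-lipschitz_on {0..Tbar} (x k)))"
proof -
  have "0 \<le> Tbar" using feas \<Omega>T by (auto simp: feasible_def)
  then consider "Tbar = 0" | "0 < Tbar" by linarith
  then show ?thesis
  proof cases
    case 1
    obtain u0 where u0: "u0 \<in> U" using H1_U(1) by blast
    have g0 [simp]: "grid Tbar k i = 0" for k i using 1 by (simp add: grid_def)
    show ?thesis
    \<comment> \<open>All grid points are \<open>0\<close>, so the half-open cells are empty and the
      discrete inclusion is vacuous; constant functions suffice.\<close>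
    proof (intro exI[of _ "\<lambda>k t. u0"] exI[of _ "\<lambda>k t. xbar 0"] exI[of _ "\<lambda>k i. 0"]
        exI[of _ "\<lambda>k i j. c j 0"] conjI ballI)
      show "\<forall>k\<ge>1. piecewise_constant Tbar k (\<lambda>t. u0) \<and> (\<forall>t\<in>{0..Tbar}. u0 \<in> U)"
        using u0 by (auto simp: piecewise_constant_def)
      show "L2_converges Tbar (\<lambda>k t. u0) ubar"
        using 1 by (simp add: L2_converges_def L2_degenerate)
      show "\<forall>k\<ge>1. piecewise_linear Tbar k (\<lambda>t. xbar 0)"
        by (auto simp: piecewise_linear_def intro!: exI[of _ "xbar 0"] exI[of _ 0])
      show "W12_converges Tbar (\<lambda>k t. xbar 0) xbar"
        using 1 by (simp add: W12_converges_def W12_on_degenerate W12_norm_def L2_degenerate)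
      fix j
      show "uniform_limit {0..Tbar} (\<lambda>k. pl_ext' Tbar k (\<lambda>i. c j 0)) (c j) sequentially"
        using 1 by (intro uniform_limitI) (simp add: pl_ext'_def pl_ext_def)
      show "uniform_limit {0..Tbar} (\<lambda>k. pl_ext Tbar k (\<lambda>i. xs j (grid Tbar k i))) (xs j) sequentially"
        using 1 by (intro uniform_limitI) (simp add: pl_ext_def)
    next
      show "\<exists>L. L-lipschitz_on {0..Tbar} xbar"
        using 1 by (intro exI[of _ 0]) (simp add: lipschitz_on_def)
      show "\<forall>L. L-lipschitz_on {0..Tbar} xbar \<longrightarrow> (\<forall>k\<ge>1. L-lipschitz_on {0..Tbar} (\<lambda>t. xbar 0))"
        by (simp add: lipschitz_on_def)
    qed simp_all
  next
    case T: 2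
    have x: "abs_cont_on Tbar xbar"
      and incl: "AE t in lebesgue. t \<in> {0..Tbar} \<longrightarrow> velocity Tbar xbar t \<in> {- v + g (xbar t) (ubar t) | v.
        v \<in> normal_cone (xbar t) (poly_set s (\<lambda>j. xs j t) (\<lambda>j. c j t))}"
      and uU: "AE t in lebesgue. t \<in> {0..Tbar} \<longrightarrow> ubar t \<in> U"
      using feas unfolding feasible_def C_def by blast+
    obtain l where l: "0 \<le> l"
      and xs_lip: "\<And>j p q. j \<in> {1..s} \<Longrightarrow> 0 \<le> p \<Longrightarrow> 0 \<le> q \<Longrightarrow> norm (xs j p - xs j q) \<le> l * \<bar>p - q\<bar>"
      and c_lip: "\<And>j p q. j \<in> {1..s} \<Longrightarrow> 0 \<le> p \<Longrightarrow> 0 \<le> q \<Longrightarrow> \<bar>c j p - c j q\<bar> \<le> l * \<bar>p - q\<bar>"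
    proof -
      obtain L where L: "\<And>j. j \<in> {1..s} \<Longrightarrow> L-lipschitz_on {0..} (xs j) \<and> L-lipschitz_on {0..} (c j)"
        using H1_lip by blast
      have le: "L * \<bar>p - q\<bar> \<le> \<bar>L\<bar> * \<bar>p - q\<bar>" for p q by (intro mult_right_mono) auto
      show ?thesis
      proof (rule that[of "\<bar>L\<bar>"])
        fix j and p q :: real assume "j \<in> {1..s}" "0 \<le> p" "0 \<le> q"
        from L[OF this(1)] this(2,3)
        show "norm (xs j p - xs j q) \<le> \<bar>L\<bar> * \<bar>p - q\<bar>" "\<bar>c j p - c j q\<bar> \<le> \<bar>L\<bar> * \<bar>p - q\<bar>"
          using le[of p q] lipschitz_onD[of L "{0..}" "xs j" p q] lipschitz_onD[of L "{0..}" "c j" p q]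
          by (auto simp: dist_norm)
      qed simp
    qed
    obtain \<eta> R where \<eta>: "0 < \<eta>" and R: "0 \<le> R"
      and slater: "\<And>t. t \<in> {0..Tbar} \<Longrightarrow> \<exists>z. norm z \<le> R \<and> (\<forall>j\<in>{1..s}. xs j t \<bullet> z \<le> c j t - \<eta>)"
    proof (rule uniform_slater[of "{0..Tbar}" s xs c])
      show "continuous_on {0..Tbar} (xs j)" "continuous_on {0..Tbar} (c j)" if "j \<in> {1..s}" for j
        using xs_lip[OF that] c_lip[OF that] l
        by (auto intro!: lipschitz_on_continuous_on[of l] lipschitz_onI simp: dist_norm)
    qed (use H2 in auto)
    obtain \<beta> where \<beta>: "0 < \<beta>" and growth: "\<And>y u. u \<in> U \<Longrightarrow> norm (g y u) \<le> \<beta> * (1 + norm y)"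
      using H3_growth by blast
    obtain K where K: "K-lipschitz_on {0..Tbar} xbar"
      using sweeping_solution_lipschitz[OF T x incl uU growth \<beta> _ _ l slater \<eta>] xs_lip c_lip by auto
    have K0: "0 \<le> K" using K by (rule lipschitz_on_nonneg)
    obtain BU where BU: "\<And>u. u \<in> U \<Longrightarrow> norm u \<le> BU" using H1_U(3) by (auto simp: bounded_iff)

    \<comment> \<open>One null set is extracted for differentiability, control constraint and
      inclusion together, so that each sampling point enjoys all three.\<close>
    have "AE t in lebesgue. t \<in> {0..Tbar} \<longrightarrow> xbar differentiable (at t within {0..Tbar})"
      using x unfolding abs_cont_on_def by blast
    with incl uU have "AE t in lebesgue. t \<in> {0..Tbar} \<longrightarrow>
        xbar differentiable (at t within {0..Tbar}) \<and> ubar t \<in> U \<and>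
        velocity Tbar xbar t \<in> {- v + g (xbar t) (ubar t) | v.
          v \<in> normal_cone (xbar t) (poly_set s (\<lambda>j. xs j t) (\<lambda>j. c j t))}"
      by eventually_elim blast
    then obtain N where N: "negligible N"
      and good: "\<And>t. t \<in> {0..Tbar} - N \<Longrightarrow> xbar differentiable (at t within {0..Tbar})"
        "\<And>t. t \<in> {0..Tbar} - N \<Longrightarrow> ubar t \<in> U"
        "\<And>t. t \<in> {0..Tbar} - N \<Longrightarrow> \<exists>v. velocity Tbar xbar t = - v + g (xbar t) (ubar t) \<and>
          v \<in> normal_cone (xbar t) (poly_set s (\<lambda>j. xs j t) (\<lambda>j. c j t))"
      unfolding eventually_ae_filter_negligible by blast
    have vel: "norm (velocity Tbar xbar t) \<le> L" if "L-lipschitz_on {0..Tbar} xbar" "t \<in> {0..Tbar} - N" for L t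
      using velocity_lipschitz_bound[OF that(1) T] good(1)[OF that(2)] that(2) by blast
    have um: "ubar \<in> borel_measurable (lebesgue_on {0..Tbar})"
      using L2 by (simp add: L2_on_def set_borel_measurable_lebesgue_on)
    have vm: "velocity Tbar xbar \<in> borel_measurable (lebesgue_on {0..Tbar})"
      using W12 by (simp add: W12_on_def L2_on_def set_borel_measurable_lebesgue_on)
    obtain S e where S: "\<And>k i. k \<ge> 1 \<Longrightarrow> i < k \<Longrightarrow> S k i \<in> {grid Tbar k i..<grid Tbar k (Suc i)} - N"
      and ev: "\<And>k. k \<ge> 1 \<Longrightarrow> integral {0..Tbar}
          (\<lambda>t. norm (velocity Tbar xbar (S k (cell Tbar k t)) - velocity Tbar xbar t)) \<le> e k"
      and eu: "\<And>k. k \<ge> 1 \<Longrightarrow> integral {0..Tbar} (\<lambda>t. norm (ubar (S k (cell Tbar k t)) - ubar t)) \<le> e k"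
      and e: "e \<longlonglongrightarrow> 0"
      by (rule simultaneous_step_sampling[OF T vm um N vel[OF K] BU[OF good(2)]]) blast+
    have SN: "S k i \<in> {0..Tbar} - N" if "1 \<le> k" "i < k" for k i
      using S[OF that] grid_cell_subset[OF T that] by fastforce

    \<comment> \<open>Discrete data and error constants\<close>
    define w where "w k i = velocity Tbar xbar (S k i)" for k i
    define X where "X k = step_primitive Tbar k (xbar 0) (w k)" for k
    define u where "u k t = ubar (S k (cell Tbar k t))" for k t
    define h where "h k = Tbar / real k" for k
    \<comment> \<open>\<open>M\<close> bounds every \<open>K\<close>-Lipschitz curve from
      \<open>xbar 0\<close>, hence \<open>xbar\<close> and all \<open>X k\<close>. In
      \<open>r\<close>, \<open>e k\<close> is the uniform distance of the curves and
      \<open>K * h k\<close> pays for the shift from grid to sampling time. \<open>d\<close> will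
      bound the shift of the right-hand sides.\<close>
    define M where "M = norm (xbar 0) + K * Tbar"
    define r where "r k = e k + K * h k" for k
    define d where "d k = l * h k * (1 + M) + r k" for k
    \<comment> \<open>A constraint active at the sampling time is moved to pass exactly through the
      discrete state, outward or inward. An inactive one is relaxed only if the state violates
      it.\<close>
    define ck where "ck k i j = (if xs j (S k i) \<bullet> xbar (S k i) = c j (S k i)
      then xs j (grid Tbar k i) \<bullet> X k (grid Tbar k i)
      else max (c j (grid Tbar k i)) (xs j (grid Tbar k i) \<bullet> X k (grid Tbar k i)))" for k i j
    define V where "V = K + \<beta> * (1 + M)"
    obtain Lg where Lg: "Lg-lipschitz_on (cball 0 M \<times> U) (\<lambda>(x, u). g x u)"
      using H3_lip[rule_format, of "cball 0 M"] by auto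
    \<comment> \<open>The first term is the bound of \<open>normal_cone_poly_perturb\<close>, with
      \<open>V\<close> bounding the normal vector, \<open>l * h k\<close> the rotation of the
      normals and \<open>R + M\<close> the distance to the Slater point. The second is the change of
      \<open>g\<close> under a shift of the state by at most \<open>r k\<close>.\<close>
    define \<tau> where "\<tau> k = V * (l * h k / \<eta>) * (R + M) + Lg * r k" for k

    have h0: "0 < h k" if "1 \<le> k" for k using that T by (simp add: h_def)
    have hlim: "h \<longlonglongrightarrow> 0" unfolding h_def by (rule lim_const_over_n)
    have rlim: "r \<longlonglongrightarrow> 0" unfolding r_def
      using tendsto_add[OF e tendsto_mult_right_zero[OF hlim, of K]] by simp
    have dlim: "d \<longlonglongrightarrow> 0" unfolding d_def
      using tendsto_add[OF tendsto_mult_left_zero[OF tendsto_mult_right_zero[OF hlim, of l], of "1 + M"] rlim] by simp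
    have \<tau>lim: "\<tau> \<longlonglongrightarrow> 0"
    proof -
      have "\<tau> = (\<lambda>k. (V * l / \<eta> * (R + M)) * h k + Lg * r k)"
        by (simp add: \<tau>_def fun_eq_iff)
      then show ?thesis
        using tendsto_add[OF tendsto_mult_right_zero[OF hlim, of "V * l / \<eta> * (R + M)"]
            tendsto_mult_right_zero[OF rlim, of Lg]] by (simp only: add_0)
    qed
    have M0: "0 \<le> M" using K0 T by (simp add: M_def)
    \<comment> \<open>The slopes are genuine derivatives of \<open>xbar\<close>, so every Lipschitz
      constant of \<open>xbar\<close> bounds them, not only \<open>K\<close>.\<close>
    have Xlip: "L-lipschitz_on {0..Tbar} (X k)" if "L-lipschitz_on {0..Tbar} xbar" "1 \<le> k" for L k
      unfolding X_def using vel[OF that(1) SN[OF that(2)]] lipschitz_on_nonneg[OF that(1)]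
      by (intro step_primitive_lipschitz[OF T that(2)]) (auto simp: w_def)
    have X0: "X k 0 = xbar 0" if "1 \<le> k" for k
      using that T by (simp add: X_def)
    have Mbound: "norm (y t) \<le> M" if y: "K-lipschitz_on {0..Tbar} y" "y 0 = xbar 0" and t: "t \<in> {0..Tbar}"
      for y :: "real \<Rightarrow> real ^ 'n" and t
    proof -
      have "norm (y t - xbar 0) \<le> K * t"
        using lipschitz_onD[OF y(1) t, of 0] y(2) t by (simp add: dist_norm)
      also have "\<dots> \<le> K * Tbar" using K0 t by (intro mult_left_mono) auto
      finally show ?thesis using norm_triangle_ineq2[of "y t" "xbar 0"] by (simp add: M_def)
    qed
    have dist: "norm (X k t - xbar t) \<le> e k" if "1 \<le> k" "t \<in> {0..Tbar}" for k t
      using step_primitive_uniform_distance[OF T that(1) x that(2), of "w k"] ev[OF that(1)]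
      by (simp add: X_def w_def)
    have e0: "0 \<le> e k" if "1 \<le> k" for k
      using dist[OF that, of 0] T norm_ge_zero[of "X k 0 - xbar 0"] by (simp add: X0[OF that])
    have r0: "0 \<le> r k" if "1 \<le> k" for k
      using e0[OF that] h0[OF that] K0 by (simp add: r_def)
    have grid01: "grid Tbar k i \<in> {0..Tbar}" if "1 \<le> k" "i < k" for k i
      using grid_cell_subset[OF T that] grid_Suc[of Tbar k i] h0[OF that(1)] by (auto simp: h_def)
    have Sgrid: "\<bar>grid Tbar k i - S k i\<bar> \<le> h k" if "1 \<le> k" "i < k" for k i
      using S[OF that] by (auto simp: grid_Suc h_def)
    have Xnear: "norm (X k (grid Tbar k i) - xbar (S k i)) \<le> r k" if "1 \<le> k" "i < k" for k i
    proof -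
      have "norm (xbar (grid Tbar k i) - xbar (S k i)) \<le> K * \<bar>grid Tbar k i - S k i\<bar>"
        using lipschitz_onD[OF K grid01[OF that], of "S k i"] SN[OF that] by (simp add: dist_norm)
      also have "\<dots> \<le> K * h k" using Sgrid[OF that] K0 by (intro mult_left_mono)
      finally show ?thesis
        using dist[OF that(1) grid01[OF that]]
          norm_triangle_ineq[of "X k (grid Tbar k i) - xbar (grid Tbar k i)" "xbar (grid Tbar k i) - xbar (S k i)"]
        by (simp add: r_def)
    qed
    have xs_near: "norm (xs j (S k i) - xs j (grid Tbar k i)) \<le> l * h k"
      and c_near: "\<bar>c j (S k i) - c j (grid Tbar k i)\<bar> \<le> l * h k"
      if "1 \<le> k" "i < k" "j \<in> {1..s}" for k i j
    proof -
      have "l * \<bar>S k i - grid Tbar k i\<bar> \<le> l * h k"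
        using Sgrid[OF that(1,2)] l by (intro mult_left_mono) (auto simp: abs_minus_commute)
      then show "norm (xs j (S k i) - xs j (grid Tbar k i)) \<le> l * h k"
        "\<bar>c j (S k i) - c j (grid Tbar k i)\<bar> \<le> l * h k"
        using xs_lip[OF that(3), of "S k i" "grid Tbar k i"] c_lip[OF that(3), of "S k i" "grid Tbar k i"]
          SN[OF that(1,2)] grid01[OF that(1,2)] by auto
    qed
    have Xfeas: "X k (grid Tbar k i) \<in> poly_set s (\<lambda>j. xs j (grid Tbar k i)) (ck k i)" for k i
      by (auto simp: mem_poly_set ck_def)
    have ck_near: "\<bar>ck k i j - c j (S k i)\<bar> \<le> d k" if k: "1 \<le> k" "i < k" and j: "j \<in> {1..s}" for k i j
    proof -
      define p where "p = xs j (grid Tbar k i) \<bullet> X k (grid Tbar k i)"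
      define q where "q = xs j (S k i) \<bullet> xbar (S k i)"
      have "xbar (S k i) \<in> poly_set s (\<lambda>j. xs j (S k i)) (\<lambda>j. c j (S k i))"
        using good(3)[OF SN[OF k]] normal_coneD by blast
      then have q: "q \<le> c j (S k i)" using j by (simp add: mem_poly_set q_def)
      have "p - q = (xs j (grid Tbar k i) - xs j (S k i)) \<bullet> X k (grid Tbar k i)
          + xs j (S k i) \<bullet> (X k (grid Tbar k i) - xbar (S k i))"
        by (simp add: p_def q_def inner_diff_left inner_diff_right)
      also have "\<bar>\<dots>\<bar> \<le> (l * h k) * M + 1 * r k"
      proof (intro order_trans[OF abs_triangle_ineq] add_mono order_trans[OF Cauchy_Schwarz_ineq2] mult_mono)
        show "norm (X k (grid Tbar k i)) \<le> M"
          using Mbound[OF Xlip[OF K k(1)] X0[OF k(1)] grid01[OF k]] .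
        show "norm (xs j (S k i)) \<le> 1" using unit j SN[OF k] by auto
      qed (use xs_near[OF k j] Xnear[OF k] l h0[OF k(1)] in \<open>auto simp: norm_minus_commute\<close>)
      finally have pq: "\<bar>p - q\<bar> \<le> l * h k * M + r k" by simp
      have "0 \<le> l * h k * M" "0 \<le> l * h k" using l h0[OF k(1)] M0 by auto
      then have d: "l * h k \<le> d k" "l * h k * M + r k \<le> d k"
        using r0[OF k(1)] by (auto simp: d_def algebra_simps)
      show ?thesis
      proof (cases "q = c j (S k i)")
        case True
        then have "ck k i j = p" by (simp add: ck_def p_def q_def)
        with True pq d show ?thesis by simp
      next
        \<comment> \<open>The maximum is at least \<open>c j (grid Tbar k i)\<close>, which is
          within \<open>l * h k\<close> of \<open>c j (S k i)\<close>. Its other entry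
          \<open>p\<close> exceeds \<open>c j (S k i)\<close> by at most the gap between
          \<open>p\<close> and \<open>q\<close>, because \<open>xbar\<close> is admissible at the
          sampling time.\<close>
        case False
        then have "ck k i j = max (c j (grid Tbar k i)) p" by (simp add: ck_def p_def q_def)
        with pq d q c_near[OF k j] show ?thesis by (auto simp: max_def abs_le_iff)
      qed
    qed

    \<comment> \<open>Convergence of the controls\<close>
    have u_conv: "L2_converges Tbar u ubar"
    proof -
      have uk: "L2_on Tbar (u k)" "(u k) \<in> borel_measurable (lebesgue_on {0..Tbar})" if "1 \<le> k" for k
      proof -
        show m: "(u k) \<in> borel_measurable (lebesgue_on {0..Tbar})"
          unfolding u_def by (rule step_measurable_lebesgue_on)
        show "L2_on Tbar (u k)"
          by (rule bounded_measurable_L2(1)[OF m negligible_empty, of BU])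
            (use BU[OF good(2)[OF SN[OF that cell_less[OF that]]]] in \<open>simp add: u_def\<close>)
      qed
      have bd: "L2_norm Tbar (\<lambda>t. u k t - ubar t) \<le> sqrt (2 * BU * e k)" if "1 \<le> k" for k
      proof -
        have "norm (u k t - ubar t) \<le> 2 * BU" if "t \<in> {0..Tbar} - N" for t
          using BU[OF good(2)[OF SN[OF \<open>1 \<le> k\<close> cell_less[OF \<open>1 \<le> k\<close>]]], of Tbar t] BU[OF good(2)[OF that]]
            norm_triangle_ineq4[of "u k t" "ubar t"] by (simp add: u_def)
        from bounded_measurable_L2(3)[OF borel_measurable_diff[OF uk(2)[OF that] um] N this]
        have "L2_norm Tbar (\<lambda>t. u k t - ubar t)
          \<le> sqrt (2 * BU * integral {0..Tbar} (\<lambda>t. norm (u k t - ubar t)))" .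
        also have "\<dots> \<le> sqrt (2 * BU * e k)"
        proof -
          have "0 \<le> BU" using H1_U(1) BU by (meson ex_in_conv norm_ge_zero order_trans)
          with eu[OF that] show ?thesis unfolding u_def
            by (intro real_sqrt_le_mono mult_left_mono) auto
        qed
        finally show ?thesis .
      qed
      have lim: "(\<lambda>k. sqrt (2 * BU * e k)) \<longlonglongrightarrow> 0"
        using tendsto_real_sqrt[OF tendsto_mult_right_zero[OF e, of "2 * BU"]] by simp
      have "(\<lambda>k. L2_norm Tbar (\<lambda>t. u k t - ubar t)) \<longlonglongrightarrow> 0"
      proof (rule tendsto_sandwich[OF _ _ tendsto_const lim])
        show "\<forall>\<^sub>F k in sequentially. L2_norm Tbar (\<lambda>t. u k t - ubar t) \<le> sqrt (2 * BU * e k)"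
          using eventually_ge_at_top[of 1] by eventually_elim (rule bd)
      qed (auto simp: L2_norm_def set_lebesgue_integral_def)
      with uk(1) L2 show ?thesis by (simp add: L2_converges_def)
    qed

    \<comment> \<open>Convergence of the trajectories\<close>
    have x_conv: "W12_converges Tbar X xbar"
    proof -
      have bd: "W12_norm Tbar (\<lambda>t. X k t - xbar t) \<le> sqrt (2 * K * e k)" if k: "1 \<le> k" for k
      proof -
        have "W12_norm Tbar (\<lambda>t. X k t - xbar t)
            \<le> sqrt (2 * K * integral {0..Tbar} (\<lambda>t. norm (w k (cell Tbar k t) - velocity Tbar xbar t)))"
          unfolding X_def using vel[OF K] SN[OF k]
          by (intro step_primitive_W12_distance[OF T k x N good(1)]) (auto simp: w_def)
        also have "\<dots> \<le> sqrt (2 * K * e k)"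
          using ev[OF k] K0 unfolding w_def by (intro real_sqrt_le_mono mult_left_mono) auto
        finally show ?thesis .
      qed
      have lim: "(\<lambda>k. sqrt (2 * K * e k)) \<longlonglongrightarrow> 0"
        using tendsto_real_sqrt[OF tendsto_mult_right_zero[OF e, of "2 * K"]] by simp
      have "(\<lambda>k. W12_norm Tbar (\<lambda>t. X k t - xbar t)) \<longlonglongrightarrow> 0"
      proof (rule tendsto_sandwich[OF _ _ tendsto_const lim])
        show "\<forall>\<^sub>F k in sequentially. W12_norm Tbar (\<lambda>t. X k t - xbar t) \<le> sqrt (2 * K * e k)"
          using eventually_ge_at_top[of 1] by eventually_elim (rule bd)
      qed (auto simp: W12_norm_def L2_norm_def set_lebesgue_integral_def)
      with W12 show ?thesis by (simp add: W12_converges_def X_def W12_on_step_primitive[OF T])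
    qed

    \<comment> \<open>The discrete inclusion\<close>
    have V0: "0 \<le> V" using K0 \<beta> M0 by (simp add: V_def)
    have Lg0: "0 \<le> Lg" using Lg by (rule lipschitz_on_nonneg)
    have \<tau>0: "0 \<le> \<tau> k" if "1 \<le> k" for k
      using V0 Lg0 r0[OF that] l h0[OF that] \<eta> R M0 by (simp add: \<tau>_def)
    have incl_k: "w k i \<in> {- v + g (X k (grid Tbar k i)) (ubar (S k i)) + \<tau> k *\<^sub>R b | v b.
        v \<in> normal_cone (X k (grid Tbar k i)) (poly_set s (\<lambda>j. xs j (grid Tbar k i)) (\<lambda>j. ck k i j)) \<and>
        b \<in> cball 0 1}" if k: "1 \<le> k" "i < k" for k i
    proof -
      define t where "t = S k i"
      define y where "y = X k (grid Tbar k i)"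
      have t: "t \<in> {0..Tbar} - N" using SN[OF k] by (simp add: t_def)
      have yM: "norm y \<le> M" unfolding y_def
        by (rule Mbound[OF Xlip[OF K k(1)] X0[OF k(1)] grid01[OF k]])
      have xM: "norm (xbar t) \<le> M" using Mbound[OF K refl, of t] t by simp
      obtain v where v: "v \<in> normal_cone (xbar t) (poly_set s (\<lambda>j. xs j t) (\<lambda>j. c j t))"
        "velocity Tbar xbar t = - v + g (xbar t) (ubar t)" using good(3)[OF t] by blast
      have "norm (g (xbar t) (ubar t)) \<le> \<beta> * (1 + norm (xbar t))" by (rule growth[OF good(2)[OF t]])
      also have "\<dots> \<le> \<beta> * (1 + M)" using xM \<beta> by (intro mult_left_mono) auto
      finally have "norm (g (xbar t) (ubar t)) \<le> \<beta> * (1 + M)" .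
      then have vV: "norm v \<le> V"
        using vel[OF K t] norm_triangle_ineq4[of "g (xbar t) (ubar t)" "velocity Tbar xbar t"] v(2)
        by (simp add: V_def)
      obtain z where z: "norm z \<le> R" "\<And>j. j \<in> {1..s} \<Longrightarrow> xs j t \<bullet> z \<le> c j t - \<eta>"
        using slater[of t] t by auto
      obtain p where p: "norm p \<le> norm v * (l * h k / \<eta>) * norm (z - xbar t)"
        "v - p \<in> normal_cone y (poly_set s (\<lambda>j. xs j (grid Tbar k i)) (ck k i))"
      proof (rule normal_cone_poly_perturb[OF v(1) _ z(2) \<eta>])
        show "norm (xs j t - xs j (grid Tbar k i)) \<le> l * h k" if "j \<in> {1..s}" for j
          using xs_near[OF k that] by (simp add: t_def)
        show "y \<in> poly_set s (\<lambda>j. xs j (grid Tbar k i)) (ck k i)" unfolding y_def by (rule Xfeas)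
        show "xs j (grid Tbar k i) \<bullet> y = ck k i j" if "xs j t \<bullet> xbar t = c j t" for j
          using that by (simp add: ck_def t_def y_def)
      qed (use l h0[OF k(1)] in auto)
      have "norm p \<le> V * (l * h k / \<eta>) * (R + M)"
        using vV V0 z(1) xM l h0[OF k(1)] \<eta> R M0 norm_triangle_ineq4[of z "xbar t"]
        by (intro order_trans[OF p(1)] mult_mono) auto
      moreover have "norm (g (xbar t) (ubar t) - g y (ubar t)) \<le> Lg * r k"
      proof -
        have "norm (g (xbar t) (ubar t) - g y (ubar t)) \<le> Lg * norm (xbar t - y)"
          using lipschitz_onD[OF Lg, of "(xbar t, ubar t)" "(y, ubar t)"] good(2)[OF t] xM yM
          by (simp add: dist_norm norm_Pair)
        also have "\<dots> \<le> Lg * r k"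
          using Xnear[OF k] Lg0 by (intro mult_left_mono) (simp_all add: t_def y_def norm_minus_commute)
        finally show ?thesis .
      qed
      ultimately have err: "norm (g (xbar t) (ubar t) - g y (ubar t) - p) \<le> \<tau> k"
        using norm_triangle_ineq4[of "g (xbar t) (ubar t) - g y (ubar t)" p] by (simp add: \<tau>_def)
      \<comment> \<open>If \<open>\<tau> k = 0\<close>, the error vanishes and
        \<open>inverse 0 = 0\<close> makes \<open>b\<close> zero, so the defining equation
        survives.\<close>
      define b where "b = (g (xbar t) (ubar t) - g y (ubar t) - p) /\<^sub>R \<tau> k"
      have b: "\<tau> k *\<^sub>R b = g (xbar t) (ubar t) - g y (ubar t) - p"
        using err by (cases "\<tau> k = 0") (auto simp: b_def)
      have "norm b = norm (g (xbar t) (ubar t) - g y (ubar t) - p) / \<tau> k"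
        using \<tau>0[OF k(1)] by (simp add: b_def divide_inverse_commute)
      also have "\<dots> \<le> 1"
        using err \<tau>0[OF k(1)] by (auto simp: divide_le_eq_1)
      finally have "b \<in> cball 0 1" by simp
      moreover have "w k i = - (v - p) + g y (ubar t) + \<tau> k *\<^sub>R b"
        unfolding b using v(2) by (simp add: w_def t_def)
      ultimately show ?thesis
        using p(2) unfolding y_def t_def
        by (intro CollectI exI[of _ "v - p"] exI[of _ b]) (auto simp: t_def y_def)
    qed

    \<comment> \<open>Assembly and convergence of the constraint data\<close>
    show ?thesis
    proof (intro exI[of _ u] exI[of _ X] exI[of _ "\<lambda>k i. \<tau> k"] exI[of _ ck] conjI ballI)
      show "\<forall>k\<ge>1. piecewise_constant Tbar k (u k) \<and> (\<forall>t\<in>{0..Tbar}. u k t \<in> U)"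
      proof (intro allI impI conjI ballI)
        fix k :: nat assume k: "1 \<le> k"
        show "piecewise_constant Tbar k (u k)"
          unfolding piecewise_constant_def
        proof (intro allI impI exI ballI)
          show "u k t = ubar (S k i)" if "i < k" "t \<in> {grid Tbar k i..<grid Tbar k (Suc i)}" for i t
            using cell_eq[OF T that] by (simp add: u_def)
        qed
        show "u k t \<in> U" for t
          unfolding u_def by (rule good(2)[OF SN[OF k cell_less[OF k]]])
      qed
      show "\<forall>k\<ge>1. piecewise_linear Tbar k (X k)"
        by (simp add: X_def piecewise_linear_step_primitive[OF T])
      show "\<forall>k\<ge>1. X k 0 = xbar 0" using X0 by simp
      show "\<forall>k\<ge>1. \<forall>i<k. \<forall>t\<in>{grid Tbar k i..<grid Tbar k (Suc i)}.
         \<exists>w. (X k has_vector_derivative w) (at_right t) \<and>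
           w \<in> {- v + g (X k (grid Tbar k i)) (u k (grid Tbar k i)) + \<tau> k *\<^sub>R b | v b.
                 v \<in> normal_cone (X k (grid Tbar k i))
                       (poly_set s (\<lambda>j. xs j (grid Tbar k i)) (\<lambda>j. ck k i j)) \<and>
                 b \<in> cball 0 1}"
      proof (intro allI impI ballI)
        fix k i t assume k: "1 \<le> k" "i < k" and t: "t \<in> {grid Tbar k i..<grid Tbar k (Suc i)}"
        \<comment> \<open>The left grid point belongs to its cell, so the control there is the
          sampled one for which \<open>incl_k\<close> was proved.\<close>
        have "u k (grid Tbar k i) = ubar (S k i)"
          using cell_eq[OF T k(2), of "grid Tbar k i"] h0[OF k(1)] by (simp add: u_def grid_Suc h_def)
        then show "\<exists>w. (X k has_vector_derivative w) (at_right t) \<and>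
           w \<in> {- v + g (X k (grid Tbar k i)) (u k (grid Tbar k i)) + \<tau> k *\<^sub>R b | v b.
                 v \<in> normal_cone (X k (grid Tbar k i))
                       (poly_set s (\<lambda>j. xs j (grid Tbar k i)) (\<lambda>j. ck k i j)) \<and>
                 b \<in> cball 0 1}"
          using incl_k[OF k] step_primitive_derivative_right[OF T k t, of "xbar 0" "w k"]
          by (intro exI[of _ "w k i"]) (simp add: X_def)
      qed
      show "\<forall>k\<ge>1. \<forall>i<k. 0 \<le> \<tau> k" using \<tau>0 by simp
      show "(\<lambda>k. (Tbar / real k) * (\<Sum>i\<in>{1..k - 1}. \<tau> k)) \<longlonglongrightarrow> 0"
      \<comment> \<open>The error is the same in all cells, so the weighted sum of
        \<open>k - 1\<close> terms is at most \<open>Tbar * \<tau> k\<close>.\<close>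
      proof (rule tendsto_sandwich[OF _ _ tendsto_const])
        show "\<forall>\<^sub>F k in sequentially. 0 \<le> (Tbar / real k) * (\<Sum>i\<in>{1..k - 1}. \<tau> k)"
          using eventually_ge_at_top[of 1] by eventually_elim (use \<tau>0 T in simp)
        show "\<forall>\<^sub>F k in sequentially. (Tbar / real k) * (\<Sum>i\<in>{1..k - 1}. \<tau> k) \<le> Tbar * \<tau> k"
          using eventually_ge_at_top[of 1]
        proof eventually_elim
          case (elim k)
          have "(Tbar / real k) * real (k - 1) \<le> Tbar" using elim T by (simp add: field_simps)
          from mult_right_mono[OF this \<tau>0[OF elim]] show ?case by simp
        qed
        show "(\<lambda>k. Tbar * \<tau> k) \<longlonglongrightarrow> 0" by (rule tendsto_mult_right_zero[OF \<tau>lim])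
      qed
      show "\<exists>L. L-lipschitz_on {0..Tbar} xbar" using K by blast
      show "\<forall>L. L-lipschitz_on {0..Tbar} xbar \<longrightarrow> (\<forall>k\<ge>1. L-lipschitz_on {0..Tbar} (X k))"
        using Xlip by blast
      fix j assume j: "j \<in> {1..s}"
      show "uniform_limit {0..Tbar} (\<lambda>k. pl_ext Tbar k (\<lambda>i. xs j (grid Tbar k i))) (xs j) sequentially"
      proof (rule pl_ext_uniform_limit[OF T])
        show "(\<lambda>k. l * h k) \<longlonglongrightarrow> 0" by (rule tendsto_mult_right_zero[OF hlim])
        fix k t m assume "1 \<le> k" "t \<in> {0..Tbar}" "\<bar>t - grid Tbar k m\<bar> \<le> Tbar / real k"
        \<comment> \<open>For \<open>m = k + 1\<close> the grid time lies beyond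
          \<open>Tbar\<close>; the Lipschitz bound for \<open>xs\<close> holds on the whole
          half-line.\<close>
        moreover have "0 \<le> grid Tbar k m" using T by (simp add: grid_def)
        ultimately show "norm (xs j (grid Tbar k m) - xs j t) \<le> l * h k"
          using xs_lip[OF j, of "grid Tbar k m" t] mult_left_mono[OF _ l, of "\<bar>t - grid Tbar k m\<bar>" "h k"]
          by (simp add: h_def abs_minus_commute)
      qed
      show "uniform_limit {0..Tbar} (\<lambda>k. pl_ext' Tbar k (\<lambda>i. ck k i j)) (c j) sequentially"
        unfolding pl_ext'_def
      \<comment> \<open>The factor 4: one mesh from \<open>t\<close> to grid point \<open>m\<close>,
        at most two from there to \<open>m'\<close> (the cut may go from \<open>k + 1\<close> to
        \<open>k - 1\<close>), and one to the sampling point.\<close>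
      proof (rule pl_ext_uniform_limit[OF T])
        show "(\<lambda>k. d k + l * (4 * h k)) \<longlonglongrightarrow> 0"
          using tendsto_add[OF dlim tendsto_mult_right_zero[OF tendsto_mult_right_zero[OF hlim, of 4], of l]]
          by simp
        fix k t m assume k: "1 \<le> k" and t: "t \<in> {0..Tbar}" and m: "m \<le> k + 1"
          and tm: "\<bar>t - grid Tbar k m\<bar> \<le> Tbar / real k"
        define m' where "m' = min m (k - 1)"
        have m': "m' < k" using k by (simp add: m'_def)
        have "m \<le> m' + 2" using m by (auto simp: m'_def)
        then have "grid Tbar k m \<le> grid Tbar k (m' + 2)" "grid Tbar k m' \<le> grid Tbar k m"
          using T by (auto intro!: grid_mono simp: m'_def)
        then have "\<bar>grid Tbar k m - grid Tbar k m'\<bar> \<le> 2 * h k"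
          by (simp add: grid_Suc h_def)
        then have "\<bar>S k m' - t\<bar> \<le> 4 * h k"
          using Sgrid[OF k m'] tm by (simp add: h_def)
        then have "l * \<bar>S k m' - t\<bar> \<le> l * (4 * h k)" using l by (rule mult_left_mono)
        moreover have "\<bar>c j (S k m') - c j t\<bar> \<le> l * \<bar>S k m' - t\<bar>"
          using SN[OF k m'] t by (intro c_lip[OF j]) auto
        ultimately show "norm (ck k (min m (k - 1)) j - c j t) \<le> d k + l * (4 * h k)"
          using ck_near[OF k m' j] unfolding m'_def by (simp add: abs_le_iff)
      qed
    qed (use u_conv x_conv in auto)
  qed
qed

end
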